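(* On $\mathbb{R}^d$, with $0=t_1<\dots<t_n=1$, $n\ge 3$, and $\rho_1,\dots,\rho_n$ probability measures on $\mathbb{R}^d$, the Kantorovich spline problem $$\min_\mu \int_{\mathcal H}|\ddot x|^2\,d\mu(x)\quad\text{subject to }[e_{t_i}]_*\mu=\rho_i,\ i=1,\dots,n,$$ over probability measures $\mu$ on $\mathcal H=H^2([0,1],\mathbb{R}^d)$, reduces to a multimarginal optimal transport problem, as follows: let $c(x_1,\dots,x_n)$ be the continuous cost of the cubic interpolant at times $t_1,\dots,t_n$; then the minimization above reduces to the minimization of $$\int_{(\mathbb{R}^d)^n}c(x_1,\dots,x_n)\,d\pi(x_1,\dots,x_n)$$ on the space of probability measures $\pi$ on $(\mathbb{R}^d)^n$ under the marginal constraints $(p_i)_*\pi=\rho_i$, $i=1,\dots,n$.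
   Context: $|\ddot x|^2$ in the first problem stands for $\int_0^1|\ddot x(t)|^2\,dt$; $e_t(x)=x(t)$ is evaluation at time $t$; $p_i:(\mathbb{R}^d)^n\to\mathbb{R}^d$ is the projection on the $i$-th factor; $f_*$ denotes pushforward of measures. For $(x_1,\dots,x_n)\in(\mathbb{R}^d)^n$, the cubic interpolant $c_{x_1,\dots,x_n}$ is the unique cubic spline minimizing the acceleration $\int_0^1|\ddot x(t)|^2\,dt$ among curves with $x(t_i)=x_i$ for $i=1,\dots,n$, and its cost $c(x_1,\dots,x_n)$ is the value of this minimum. *)

theory Defs
  imports "HOL-Probability.Probability"
begin

section \<open>The Sobolev space of curves with square integrable acceleration\<close>

text \<open>
  A class in \<open>H\<^sup>2([0,1])\<close> is represented by its unique \<open>C\<^sup>1\<close> member, so that evaluation at a time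
  makes sense.  Such a curve is an element of \<open>H\<^sup>2\<close> with second derivative \<open>w\<close> iff it is differentiable
  on \<open>[0,1]\<close> and its derivative is absolutely continuous, being the primitive of the square
  integrable function \<open>w\<close>; \<open>w\<close> is determined up to a null set.
\<close>

definition has_second_derivative :: "(real \<Rightarrow> 'a::euclidean_space) \<Rightarrow> (real \<Rightarrow> 'a) \<Rightarrow> bool" where
  "has_second_derivative x w \<longleftrightarrow>
     set_borel_measurable lborel {0..1} w \<and>
     set_integrable lborel {0..1} (\<lambda>s. (norm (w s))\<^sup>2) \<and>
     (\<exists>v. \<forall>s\<in>{0..1}. (x has_vector_derivative v s) (at s within {0..1}) \<and>
          v s = v 0 + (LINT r:{0..s}|lborel. w r))"

text \<open>
  Functions on \<open>[0,1]\<close> are encoded by their extension by \<open>0\<close>; this keeps the space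
  closed under pointwise linear combinations.
\<close>

definition H2 :: "(real \<Rightarrow> 'a::euclidean_space) set" where
  "H2 = {x. (\<exists>w. has_second_derivative x w) \<and> (\<forall>s. s \<notin> {0..1} \<longrightarrow> x s = 0)}"

definition velocity :: "(real \<Rightarrow> 'a::euclidean_space) \<Rightarrow> real \<Rightarrow> 'a" where
  "velocity x s = vector_derivative x (at s within {0..1})"

definition acceleration :: "(real \<Rightarrow> 'a::euclidean_space) \<Rightarrow> real \<Rightarrow> 'a" where
  "acceleration x = (SOME w. has_second_derivative x w)"

definition acc_energy :: "(real \<Rightarrow> 'a::euclidean_space) \<Rightarrow> real" where
  "acc_energy x = (LINT s:{0..1}|lborel. (norm (acceleration x s))\<^sup>2)"

definition H2_norm :: "(real \<Rightarrow> 'a::euclidean_space) \<Rightarrow> real" where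
  "H2_norm x =
     sqrt ((LINT s:{0..1}|lborel. (norm (x s))\<^sup>2) +
           (LINT s:{0..1}|lborel. (norm (velocity x s))\<^sup>2) + acc_energy x)"

text \<open>The Borel \<open>\<sigma>\<close>-algebra of the norm topology on \<^const>\<open>H2\<close>.\<close>

definition H2_borel :: "(real \<Rightarrow> 'a::euclidean_space) measure" where
  "H2_borel = sigma H2
     {U. U \<subseteq> H2 \<and> (\<forall>x\<in>U. \<exists>e>0. \<forall>y\<in>H2. H2_norm (\<lambda>s. y s - x s) < e \<longrightarrow> y \<in> U)}"


section \<open>Cubic interpolation\<close>

definition cubic_spline :: "nat \<Rightarrow> (nat \<Rightarrow> real) \<Rightarrow> (real \<Rightarrow> 'a::euclidean_space) \<Rightarrow> bool" where
  "cubic_spline n t z \<longleftrightarrow>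
     (\<exists>v a. (\<forall>s\<in>{0..1}. (z has_vector_derivative v s) (at s within {0..1}) \<and>
                         (v has_vector_derivative a s) (at s within {0..1})) \<and>
            continuous_on {0..1} a) \<and>
     (\<forall>i\<in>{1..<n}. \<exists>c0 c1 c2 c3. \<forall>s\<in>{t i..t (Suc i)}.
        z s = c0 + s *\<^sub>R c1 + s^2 *\<^sub>R c2 + s^3 *\<^sub>R c3)"

definition is_cubic_interpolant ::
    "nat \<Rightarrow> (nat \<Rightarrow> real) \<Rightarrow> (nat \<Rightarrow> 'a::euclidean_space) \<Rightarrow> (real \<Rightarrow> 'a) \<Rightarrow> bool" where
  "is_cubic_interpolant n t x z \<longleftrightarrow>
     cubic_spline n t z \<and>
     is_arg_min acc_energy (\<lambda>y. y \<in> H2 \<and> (\<forall>i\<in>{1..n}. y (t i) = x i)) z"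

definition cubic_interpolant ::
    "nat \<Rightarrow> (nat \<Rightarrow> real) \<Rightarrow> (nat \<Rightarrow> 'a::euclidean_space) \<Rightarrow> real \<Rightarrow> 'a" where
  "cubic_interpolant n t x = (THE z. is_cubic_interpolant n t x z)"

definition interpolant_cost ::
    "nat \<Rightarrow> (nat \<Rightarrow> real) \<Rightarrow> (nat \<Rightarrow> 'a::euclidean_space) \<Rightarrow> real" where
  "interpolant_cost n t x = acc_energy (cubic_interpolant n t x)"


section \<open>The two variational problems\<close>

text \<open>
  Points of the \<open>n\<close>-fold product are extensional functions on \<open>{1..n}\<close>.  Both costs take values in
  \<open>[0,\<infinity>]\<close>, since no moment assumption is made on the marginals.
\<close>

abbreviation tuples :: "nat \<Rightarrow> (nat \<Rightarrow> 'a::euclidean_space) set" where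
  "tuples n \<equiv> {1..n} \<rightarrow>\<^sub>E UNIV"

abbreviation tuple_borel :: "nat \<Rightarrow> (nat \<Rightarrow> 'a::euclidean_space) measure" where
  "tuple_borel n \<equiv> PiM {1..n} (\<lambda>_. borel)"

definition curve_plans ::
    "nat \<Rightarrow> (nat \<Rightarrow> real) \<Rightarrow> (nat \<Rightarrow> 'a::euclidean_space measure) \<Rightarrow> (real \<Rightarrow> 'a) measure set" where
  "curve_plans n t \<rho> =
     {\<mu>. prob_space \<mu> \<and> sets \<mu> = sets H2_borel \<and>
          (\<forall>i\<in>{1..n}. distr \<mu> borel (\<lambda>x. x (t i)) = \<rho> i)}"

definition curve_cost :: "(real \<Rightarrow> 'a::euclidean_space) measure \<Rightarrow> ennreal" where
  "curve_cost \<mu> = (\<integral>\<^sup>+ x. ennreal (acc_energy x) \<partial>\<mu>)"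

definition couplings ::
    "nat \<Rightarrow> (nat \<Rightarrow> 'a::euclidean_space measure) \<Rightarrow> (nat \<Rightarrow> 'a) measure set" where
  "couplings n \<rho> =
     {\<pi>. prob_space \<pi> \<and> sets \<pi> = sets (tuple_borel n) \<and>
          (\<forall>i\<in>{1..n}. distr \<pi> borel (\<lambda>x. x i) = \<rho> i)}"

definition coupling_cost ::
    "nat \<Rightarrow> (nat \<Rightarrow> real) \<Rightarrow> (nat \<Rightarrow> 'a::euclidean_space) measure \<Rightarrow> ennreal" where
  "coupling_cost n t \<pi> = (\<integral>\<^sup>+ x. ennreal (interpolant_cost n t x) \<partial>\<pi>)"

definition joint_marginal ::
    "nat \<Rightarrow> (nat \<Rightarrow> real) \<Rightarrow> (real \<Rightarrow> 'a::euclidean_space) measure \<Rightarrow> (nat \<Rightarrow> 'a) measure" where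
  "joint_marginal n t \<mu> = distr \<mu> (tuple_borel n) (\<lambda>x. \<lambda>i\<in>{1..n}. x (t i))"

definition spline_lift ::
    "nat \<Rightarrow> (nat \<Rightarrow> real) \<Rightarrow> (nat \<Rightarrow> 'a::euclidean_space) measure \<Rightarrow> (real \<Rightarrow> 'a) measure" where
  "spline_lift n t \<pi> = distr \<pi> H2_borel (cubic_interpolant n t)"

end

theory Submission
  imports Defs "HOL-Computational_Algebra.Polynomial"
begin

text \<open>
  The cardinal interpolants are natural splines \<open>a + b s + (\<Sum>\<tau>. l \<tau> (\<tau> - s)\<^sub>+\<^sup>3 / 6)\<close> whose weights at the
  nodes have vanishing moments of order \<open>0\<close> and \<open>1\<close>.  By Taylor's formula the acceleration of such a
  spline is orthogonal to that of every curve in \<open>H\<^sup>2\<close> vanishing at the nodes, so that the energy of a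
  curve is the energy of its interpolant plus the energy of the difference, and the interpolant is the
  unique minimizer.  It depends linearly on the data, hence continuously in \<open>H\<^sup>2\<close>, and its cost is a
  quadratic form.  Restriction to the nodes therefore does not increase the cost of a plan, and
  pushing a coupling forward along the interpolation map is a right inverse that preserves the cost.
\<close>

subsection \<open>Calculus of second derivatives\<close>

text \<open>The moment conditions say that the functional sending a curve \<open>y\<close> to the
  weighted sum of its nodal values annihilates affine curves. Exactly then it depends on
  \<open>y\<close> only through the acceleration, and Taylor's formula names its Riesz
  representative: the acceleration of the spline. The truncated cube at node 0 vanishes on [0,1], so
  the weight at 0 is free to balance the moment of order 0; the moment of order 1 makes the
  acceleration vanish at time 0, and at time 1 it vanishes by truncation. Existence of interpolating
  splines is the solvability of a linear system; induction on the nodes reduces it to the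
  nonvanishing of one number per node. Two obstacles shape the rest. The acceleration is an
  arbitrary representative, so energies can be computed only after uniqueness almost everywhere is
  known. The Borel sets of \<open>H2\<close> come from the norm, so the interpolation map must be
  shown continuous into that norm, not just at each time. Uniqueness of the minimizing curve has a
  counterpart for plans: a minimal plan of finite cost is concentrated on splines and is therefore
  the lift of its joint marginal.\<close>

lemma set_integrable_if_square_integrable:
  fixes w :: "real \<Rightarrow> 'a::euclidean_space"
  assumes "set_borel_measurable lborel {0..1} w"
    and "set_integrable lborel {0..1} (\<lambda>s. (norm (w s))\<^sup>2)"
  shows "set_integrable lborel {0..1} w"
proof (rule set_integrable_bound[OF _ assms(1)])
  show "set_integrable lborel {0..1} (\<lambda>s. 1 + (norm (w s))\<^sup>2)"
    using assms(2) borel_integrable_atLeastAtMost'[of 0 1 "\<lambda>_. 1::real"] by (intro set_integral_add) auto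
  have "norm (w s) \<le> 1 + (norm (w s))\<^sup>2" for s
  proof -
    have "2 * norm (w s) \<le> (norm (w s))\<^sup>2 + 1" using sum_squares_bound[of "norm (w s)" 1] by simp
    then show ?thesis using norm_ge_zero[of "w s"] by linarith
  qed
  then show "AE x in lborel. x \<in> {0..1} \<longrightarrow> norm (w x) \<le> norm (1 + (norm (w x))\<^sup>2)"
    by auto
qed

lemma has_second_derivativeI:
  assumes "set_borel_measurable lborel {0..1} w"
    and "set_integrable lborel {0..1} (\<lambda>s. (norm (w s))\<^sup>2)"
    and "\<And>s. s \<in> {0..1} \<Longrightarrow> (x has_vector_derivative v s) (at s within {0..1}) \<and>
          v s = v 0 + (LINT r:{0..s}|lborel. w r)"
  shows "has_second_derivative x w"
  unfolding has_second_derivative_def using assms by blast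

lemma has_second_derivative_integrable:
  assumes "has_second_derivative x w"
  shows "set_integrable lborel {0..1} w"
  using assms by (auto simp: has_second_derivative_def intro: set_integrable_if_square_integrable)

lemma set_integrable_inner_square:
  fixes w u :: "real \<Rightarrow> 'a::euclidean_space"
  assumes w: "set_borel_measurable lborel {0..1} w" "set_integrable lborel {0..1} (\<lambda>s. (norm (w s))\<^sup>2)"
    and u: "set_borel_measurable lborel {0..1} u" "set_integrable lborel {0..1} (\<lambda>s. (norm (u s))\<^sup>2)"
  shows "set_integrable lborel {0..1} (\<lambda>s. w s \<bullet> u s)"
proof (rule set_integrable_bound)
  show "set_integrable lborel {0..1} (\<lambda>s. (norm (w s))\<^sup>2 + (norm (u s))\<^sup>2)"
    using w(2) u(2) by (rule set_integral_add)
  have "(\<lambda>s. (indicator {0..1} s *\<^sub>R w s) \<bullet> (indicator {0..1} s *\<^sub>R u s)) \<in> borel_measurable lborel"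
    using w(1) u(1) unfolding set_borel_measurable_def by (rule borel_measurable_inner)
  also have "(\<lambda>s. (indicator {0..1} s *\<^sub>R w s) \<bullet> (indicator {0..1} s *\<^sub>R u s)) =
    (\<lambda>s. indicator {0..1} s *\<^sub>R (w s \<bullet> u s))"
    by (auto simp: indicator_def)
  finally show "set_borel_measurable lborel {0..1} (\<lambda>s. w s \<bullet> u s)"
    unfolding set_borel_measurable_def .
  have "\<bar>w s \<bullet> u s\<bar> \<le> (norm (w s))\<^sup>2 + (norm (u s))\<^sup>2" for s
  proof -
    have "\<bar>w s \<bullet> u s\<bar> \<le> norm (w s) * norm (u s)"
      by (rule Cauchy_Schwarz_ineq2)
    also have "\<dots> \<le> 2 * norm (w s) * norm (u s)" by simp
    also have "\<dots> \<le> (norm (w s))\<^sup>2 + (norm (u s))\<^sup>2" by (rule sum_squares_bound)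
    finally show ?thesis .
  qed
  then show "AE x in lborel. x \<in> {0..1} \<longrightarrow> norm (w x \<bullet> u x) \<le> norm ((norm (w x))\<^sup>2 + (norm (u x))\<^sup>2)"
    by auto
qed

lemma has_second_derivative_inner_integrable:
  assumes "has_second_derivative x w" "has_second_derivative y u"
  shows "set_integrable lborel {0..1} (\<lambda>s. w s \<bullet> u s)"
  using assms by (intro set_integrable_inner_square) (auto simp: has_second_derivative_def)

lemma set_integrable_initial_segment:
  fixes w :: "real \<Rightarrow> 'a::euclidean_space"
  assumes "set_integrable lborel {0..1} w" "s \<in> {0..1}"
  shows "set_integrable lborel {0..s} w"
  using assms by (auto intro: set_integrable_subset)

section \<open>Stability of second derivatives under sums, linear maps and differences\<close>

lemma has_second_derivative_add:
  assumes x: "has_second_derivative x w" and y: "has_second_derivative y u"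
  shows "has_second_derivative (\<lambda>s. x s + y s) (\<lambda>s. w s + u s)"
proof -
  have wu: "set_integrable lborel {0..1} w" "set_integrable lborel {0..1} u"
    using x y by (auto intro: has_second_derivative_integrable)
  have "set_integrable lborel {0..1} (\<lambda>s. (norm (w s))\<^sup>2 + 2 * (w s \<bullet> u s) + (norm (u s))\<^sup>2)"
    using x y has_second_derivative_inner_integrable[OF x y]
    by (intro set_integral_add set_integrable_mult_right) (auto simp: has_second_derivative_def)
  moreover have "(norm (w s + u s))\<^sup>2 = (norm (w s))\<^sup>2 + 2 * (w s \<bullet> u s) + (norm (u s))\<^sup>2" for s
    by (simp add: power2_norm_eq_inner algebra_simps inner_commute)
  ultimately have sq: "set_integrable lborel {0..1} (\<lambda>s. (norm (w s + u s))\<^sup>2)" by simp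
  have "set_integrable lborel {0..1} (\<lambda>s. w s + u s)"
    using wu by (rule set_integral_add)
  then have m: "set_borel_measurable lborel {0..1} (\<lambda>s. w s + u s)"
    unfolding set_integrable_def set_borel_measurable_def by (rule borel_measurable_integrable)
  from x obtain v where v: "\<forall>s\<in>{0..1}. (x has_vector_derivative v s) (at s within {0..1}) \<and>
          v s = v 0 + (LINT r:{0..s}|lborel. w r)" unfolding has_second_derivative_def by blast
  from y obtain v' where v': "\<forall>s\<in>{0..1}. (y has_vector_derivative v' s) (at s within {0..1}) \<and>
          v' s = v' 0 + (LINT r:{0..s}|lborel. u r)" unfolding has_second_derivative_def by blast
  have "((\<lambda>s. x s + y s) has_vector_derivative v s + v' s) (at s within {0..1}) \<and>
          v s + v' s = v 0 + v' 0 + (LINT r:{0..s}|lborel. w r + u r)" if s: "s \<in> {0..1}" for s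
    using v[rule_format, OF s] v'[rule_format, OF s]
      set_integral_add(2)[OF set_integrable_initial_segment[OF wu(1) s] set_integrable_initial_segment[OF wu(2) s]]
    by (auto intro!: has_vector_derivative_add)
  with m sq show ?thesis by (rule has_second_derivativeI)
qed

lemma has_second_derivative_linear:
  fixes h :: "'a::euclidean_space \<Rightarrow> 'b::euclidean_space"
  assumes h: "bounded_linear h" and x: "has_second_derivative x w"
  shows "has_second_derivative (\<lambda>s. h (x s)) (\<lambda>s. h (w s))"
proof -
  interpret bounded_linear h by (rule h)
  obtain K where K: "\<And>z. norm (h z) \<le> norm z * K" using bounded by blast
  have w: "set_integrable lborel {0..1} w" using x by (rule has_second_derivative_integrable)
  have hw: "set_integrable lborel A (\<lambda>s. h (w s))"
     "(LINT r:A|lborel. h (w r)) = h (LINT r:A|lborel. w r)"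
    if "set_integrable lborel A w" for A
    using integrable_bounded_linear[OF h, of lborel "\<lambda>s. indicator A s *\<^sub>R w s"]
      integral_bounded_linear[OF h, of lborel "\<lambda>s. indicator A s *\<^sub>R w s"] that
    by (simp_all add: set_integrable_def set_lebesgue_integral_def scale)
  have m: "set_borel_measurable lborel {0..1} (\<lambda>s. h (w s))"
    using hw(1)[OF w] unfolding set_integrable_def set_borel_measurable_def
    by (rule borel_measurable_integrable)
  have sq: "set_integrable lborel {0..1} (\<lambda>s. (norm (h (w s)))\<^sup>2)"
  proof (rule set_integrable_bound)
    show "set_integrable lborel {0..1} (\<lambda>s. (norm (w s))\<^sup>2 * K\<^sup>2)"
      using x by (intro set_integrable_mult_left) (simp add: has_second_derivative_def)
    have "(\<lambda>s. (norm (indicator {0..1} s *\<^sub>R h (w s)))\<^sup>2) \<in> borel_measurable lborel"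
      using m unfolding set_borel_measurable_def by measurable
    then show "set_borel_measurable lborel {0..1} (\<lambda>s. (norm (h (w s)))\<^sup>2)"
      unfolding set_borel_measurable_def
      by (rule measurable_cong[THEN iffD1, rotated]) (auto simp: indicator_def)
    have "norm ((norm (h (w s)))\<^sup>2) \<le> norm ((norm (w s))\<^sup>2 * K\<^sup>2)" for s
      using power_mono[OF K[of "w s"] norm_ge_zero, of 2] by (simp add: power_mult_distrib)
    then show "AE s in lborel. s \<in> {0..1} \<longrightarrow> norm ((norm (h (w s)))\<^sup>2) \<le> norm ((norm (w s))\<^sup>2 * K\<^sup>2)"
      by simp
  qed
  from x obtain v where v: "\<forall>s\<in>{0..1}. (x has_vector_derivative v s) (at s within {0..1}) \<and>
          v s = v 0 + (LINT r:{0..s}|lborel. w r)" unfolding has_second_derivative_def by blast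
  have "((\<lambda>s. h (x s)) has_vector_derivative h (v s)) (at s within {0..1}) \<and>
          h (v s) = h (v 0) + (LINT r:{0..s}|lborel. h (w r))" if s: "s \<in> {0..1}" for s
  proof -
    have "v s = v 0 + (LINT r:{0..s}|lborel. w r)" using v s by blast
    then have "h (v s) = h (v 0) + (LINT r:{0..s}|lborel. h (w r))"
      using hw(2)[OF set_integrable_initial_segment[OF w s]] by (metis add)
    then show ?thesis using v s has_vector_derivative by blast
  qed
  with m sq show ?thesis by (rule has_second_derivativeI)
qed

lemma has_second_derivative_diff:
  assumes "has_second_derivative x w" "has_second_derivative y u"
  shows "has_second_derivative (\<lambda>s. x s - y s) (\<lambda>s. w s - u s)"
  using has_second_derivative_add[OF assms(1) has_second_derivative_linear[OF _ assms(2), of uminus]]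
  by (simp add: bounded_linear_minus[OF bounded_linear_ident])

lemma has_second_derivative_C2:
  fixes x :: "real \<Rightarrow> 'a::euclidean_space"
  assumes "\<And>s. s \<in> {0..1} \<Longrightarrow> (x has_vector_derivative v s) (at s within {0..1})"
    and v: "\<And>s. s \<in> {0..1} \<Longrightarrow> (v has_vector_derivative a s) (at s within {0..1})"
    and a: "continuous_on {0..1} a"
  shows "has_second_derivative x a"
proof -
  have "(x has_vector_derivative v s) (at s within {0..1}) \<and>
      v s = v 0 + (LINT r:{0..s}|lborel. a r)" if s: "s \<in> {0..1}" for s
  proof -
    have "integral\<^sup>L lborel (\<lambda>r. indicator {0..s} r *\<^sub>R a r) = v s - v 0"
      using s continuous_on_subset[OF a] has_vector_derivative_within_subset[OF v, of _ "{0..s}"]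
      by (intro integral_FTC_atLeastAtMost) auto
    then show ?thesis using assms(1)[OF s] by (simp add: set_lebesgue_integral_def)
  qed
  moreover have "set_borel_measurable lborel {0..1} a"
    using borel_integrable_atLeastAtMost'[OF a] unfolding set_borel_measurable_def set_integrable_def
    by (rule borel_measurable_integrable)
  moreover have "set_integrable lborel {0..1} (\<lambda>s. (norm (a s))\<^sup>2)"
    using a by (intro borel_integrable_atLeastAtMost' continuous_intros)
  ultimately show ?thesis by (intro has_second_derivativeI)
qed

text \<open>The derivative \<open>v\<close> in \<open>has_second_derivative\<close> is only asserted
  to exist; derivatives within a nondegenerate interval are unique, so it agrees with
  \<open>velocity x\<close> on [0,1].\<close>

lemma
  assumes x: "has_second_derivative x w" and s: "s \<in> {0..1}"
  shows has_vector_derivative_velocity: "(x has_vector_derivative velocity x s) (at s within {0..1})"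
    and velocity_eq: "velocity x s = velocity x 0 + (LINT r:{0..s}|lborel. w r)"
proof -
  obtain v where v: "\<And>s. s\<in>{0..1} \<Longrightarrow> (x has_vector_derivative v s) (at s within {0..1})"
      "\<And>s. s\<in>{0..1} \<Longrightarrow> v s = v 0 + (LINT r:{0..s}|lborel. w r)"
    using x unfolding has_second_derivative_def by blast
  have *: "velocity x s = v s" if "s \<in> {0..1}" for s
    unfolding velocity_def using that v(1) by (intro vector_derivative_within_closed_interval) auto
  show "(x has_vector_derivative velocity x s) (at s within {0..1})"
    using *[OF s] v(1)[OF s] by simp
  show "velocity x s = velocity x 0 + (LINT r:{0..s}|lborel. w r)"
    using *[OF s] *[of 0] v(2)[OF s] by simp
qed

lemma continuous_on_velocity:
  assumes "has_second_derivative x w"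
  shows "continuous_on {0..1} (velocity x)"
proof -
  have w: "set_integrable lborel {0..1} w" using assms by (rule has_second_derivative_integrable)
  have "continuous_on {0..1} (\<lambda>s. velocity x 0 + integral {0..s} w)"
    using set_borel_integral_eq_integral(1)[OF w]
    by (intro continuous_intros indefinite_integral_continuous_1)
  moreover have "velocity x s = velocity x 0 + integral {0..s} w" if "s \<in> {0..1}" for s
    using velocity_eq[OF assms that] set_borel_integral_eq_integral(2)[OF set_integrable_initial_segment[OF w that]]
    by simp
  ultimately show ?thesis by (metis (no_types, lifting) continuous_on_cong)
qed

lemma has_second_derivative_continuous_on:
  assumes "has_second_derivative x w"
  shows "continuous_on {0..1} x"
  using has_vector_derivative_velocity[OF assms] has_vector_derivative_continuous
  unfolding continuous_on_eq_continuous_within by blast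

text \<open>The sets over which the integral of the function vanishes contain all intervals and are
  closed under complements and disjoint countable unions, hence include every Borel set. An
  integrable function with this property is 0 almost everywhere.\<close>

lemma AE_zero_if_initial_integrals_zero:
  fixes d :: "real \<Rightarrow> 'a::euclidean_space"
  assumes d: "set_integrable lborel {0..1} d"
    and zero: "\<And>s. s \<in> {0..1} \<Longrightarrow> (LINT r:{0..s}|lborel. d r) = 0"
  shows "AE s in lborel. s \<in> {0..1} \<longrightarrow> d s = 0"
proof -
  \<comment> \<open>Extension by 0 makes the function integrable on the whole line, so that the
    induction can range over all Borel sets.\<close>
  define D where "D = (\<lambda>s. indicator {0..1} s *\<^sub>R d s)"
  have D: "integrable lborel D" using d by (simp add: D_def set_integrable_def)
  have D_on: "set_integrable lborel B D" if "B \<in> sets borel" for B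
    using integrable_mult_indicator[OF _ D, of B] that by (simp add: set_integrable_def)
  have total: "integral\<^sup>L lborel D = 0" using zero[of 1] by (simp add: D_def set_lebesgue_integral_def)
  have initial: "integral {0..s} d = 0" if "s \<in> {0..1}" for s
    using zero[OF that] set_borel_integral_eq_integral(2)[OF set_integrable_initial_segment[OF d that]] by simp
  have "(LINT s:B|lborel. D s) = 0" if "B \<in> sets borel" for B
    using that
  proof (induction rule: borel_set_induct)
    case empty
    show ?case by (simp add: set_lebesgue_integral_def)
  next
    case (interval a b)
    \<comment> \<open>The interval is clipped to [0,1]; over the clipped interval the integral is a
      difference of two initial ones.\<close>
    define a' where "a' = max a 0"
    define b' where "b' = min b 1"
    have "(LINT s:{a..b}|lborel. D s) = (LINT s:{a'..b'}|lborel. d s)"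
      unfolding set_lebesgue_integral_def D_def a'_def b'_def
      by (intro Bochner_Integration.integral_cong) (auto simp: indicator_def)
    also have "\<dots> = 0"
    proof (cases "a' \<le> b'")
      case True
      then have *: "a' \<in> {0..1}" "b' \<in> {0..1}" by (auto simp: a'_def b'_def)
      have "set_integrable lborel {a'..b'} d"
        using * by (intro set_integrable_subset[OF d]) auto
      then have "(LINT s:{a'..b'}|lborel. d s) = integral {a'..b'} d"
        by (rule set_borel_integral_eq_integral)
      also have "\<dots> = 0"
        using Henstock_Kurzweil_Integration.integral_combine[of 0 a' b' d] initial[OF *(1)] initial[OF *(2)] True *
          set_borel_integral_eq_integral(1)[OF set_integrable_initial_segment[OF d *(2)]] by auto
      finally show ?thesis .
    qed (simp add: set_lebesgue_integral_def)
    finally show ?case .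
  next
    \<comment> \<open>The complement inherits the property because the total integral is 0, which is
      the hypothesis at time 1.\<close>
    case (compl B)
    have "integral\<^sup>L lborel D = (LINT s:B \<union> -B|lborel. D s)"
      by (simp add: set_lebesgue_integral_def)
    also have "\<dots> = (LINT s:B|lborel. D s) + (LINT s:-B|lborel. D s)"
      using compl.hyps by (intro set_integral_Un D_on) auto
    finally show ?case using total compl by simp
  next
    case (union B)
    have "(LINT s:(\<Union>i. B i)|lborel. D s) = (\<Sum>i. (LINT s:B i|lborel. D s))"
      using union.hyps by (intro lebesgue_integral_countable_add D_on) (auto simp: disjoint_family_on_def)
    then show ?case using union by simp
  qed
  then have "AE s in lborel. D s = 0"
    using D by (intro sigma_finite_measure.density_zero[OF sigma_finite_lborel]) auto
  then show ?thesis by eventually_elim (auto simp: D_def)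
qed

text \<open>The velocity depends on the curve alone, so both candidates have the same
  primitive.\<close>

lemma has_second_derivative_unique:
  assumes "has_second_derivative x w" "has_second_derivative x u"
  shows "AE s in lborel. s \<in> {0..1} \<longrightarrow> w s = u s"
proof -
  note wu = assms[THEN has_second_derivative_integrable]
  have "AE s in lborel. s \<in> {0..1} \<longrightarrow> w s - u s = 0"
  proof (rule AE_zero_if_initial_integrals_zero)
    show "set_integrable lborel {0..1} (\<lambda>s. w s - u s)" using wu by (rule set_integral_diff)
    show "(LINT r:{0..s}|lborel. w r - u r) = 0" if "s \<in> {0..1}" for s
      using velocity_eq[OF assms(1) that] velocity_eq[OF assms(2) that]
        set_integral_diff(2)[OF set_integrable_initial_segment[OF wu(1) that] set_integrable_initial_segment[OF wu(2) that]]
      by simp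
  qed
  then show ?thesis by eventually_elim simp
qed

text \<open>Frees the energy from the arbitrary choice in \<open>acceleration\<close>: any explicit
  second derivative may be used to compute it.\<close>

lemma acc_energy_eq:
  assumes x: "has_second_derivative x w"
  shows "acc_energy x = (LINT s:{0..1}|lborel. (norm (w s))\<^sup>2)"
proof -
  have a: "has_second_derivative x (acceleration x)"
    unfolding acceleration_def using someI[of "has_second_derivative x", OF x] .
  have "(\<lambda>s. indicator {0..1} s *\<^sub>R (norm (u s))\<^sup>2) \<in> borel_measurable lborel"
    if "has_second_derivative x u" for u
    using that unfolding has_second_derivative_def set_integrable_def by (auto intro: borel_measurable_integrable)
  with a x has_second_derivative_unique[OF a x] show ?thesis
    unfolding acc_energy_def set_lebesgue_integral_def
    by (intro integral_cong_AE) (auto simp: indicator_def)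
qed

lemma acc_energy_nonneg: "0 \<le> acc_energy x"
  unfolding acc_energy_def set_lebesgue_integral_def by (intro integral_nonneg_AE) auto

text \<open>Fubini's theorem turns the double primitive of the second derivative into an integral against this kernel.\<close>

lemma taylor_kernel_integral:
  assumes x: "has_second_derivative x w" and c: "c \<in> {0..1}"
  shows "(LINT r:{0..1}|lborel. max 0 (c - r) *\<^sub>R w r) = x c - x 0 - c *\<^sub>R velocity x 0"
proof -
  define W where "W = (\<lambda>s. indicator {0..1} s *\<^sub>R w s)"
  have W: "integrable lborel W"
    using has_second_derivative_integrable[OF x] by (simp add: W_def set_integrable_def)
  note [measurable] = borel_measurable_integrable[OF W]
  \<comment> \<open>The integrand lives on the triangle \<open>r \<le> s \<le> c\<close>.
    Integrating over \<open>s\<close> first produces the kernel; integrating over \<open>r\<close>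
    first produces the velocity increment at \<open>s\<close>.\<close>
  define f where "f = (\<lambda>r s. if r \<le> s \<and> 0 \<le> s \<and> s \<le> c then W r else 0)"
  have f_ind: "f r s = indicator {r..c} s *\<^sub>R W r" for r s
    by (auto simp: f_def W_def indicator_def)
  have f_inner: "(\<integral>s. f r s \<partial>lborel) = max 0 (c - r) *\<^sub>R W r" for r
    by (simp add: f_ind measure_def emeasure_lborel_Icc_eq max_def)
  have f_norm: "(\<integral>s. norm (f r s) \<partial>lborel) = max 0 (c - r) * norm (W r)" for r
    by (simp add: f_ind measure_def emeasure_lborel_Icc_eq max_def)
  have int: "integrable (lborel \<Otimes>\<^sub>M lborel) (case_prod f)"
  proof (rule lborel_pair.Fubini_integrable)
    show "case_prod f \<in> borel_measurable (lborel \<Otimes>\<^sub>M lborel)"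
      unfolding f_def by measurable
    show "integrable lborel (\<lambda>r. \<integral>s. norm (case_prod f (r, s)) \<partial>lborel)"
      unfolding case_prod_conv f_norm
    proof (rule Bochner_Integration.integrable_bound[OF W])
      show "AE r in lborel. norm (max 0 (c - r) * norm (W r)) \<le> norm (W r)"
        using c by (auto simp: W_def indicator_def abs_mult intro!: mult_left_le_one_le)
    qed measurable
    show "AE r in lborel. integrable lborel (\<lambda>s. case_prod f (r, s))"
      using borel_integrable_compact[of "{_..c}" "\<lambda>_. W _"] by (auto simp: f_ind)
  qed
  have "(LINT r:{0..1}|lborel. max 0 (c - r) *\<^sub>R w r) = (\<integral>r. (\<integral>s. f r s \<partial>lborel) \<partial>lborel)"
    unfolding f_inner set_lebesgue_integral_def
    by (intro Bochner_Integration.integral_cong) (auto simp: W_def)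
  also have "\<dots> = (\<integral>s. (\<integral>r. f r s \<partial>lborel) \<partial>lborel)"
    using lborel_pair.Fubini_integral[OF int] by simp
  also have "\<dots> = (\<integral>s. indicator {0..c} s *\<^sub>R (velocity x s - velocity x 0) \<partial>lborel)"
  proof (intro Bochner_Integration.integral_cong refl)
    fix s
    show "(\<integral>r. f r s \<partial>lborel) = indicator {0..c} s *\<^sub>R (velocity x s - velocity x 0)"
    proof (cases "s \<in> {0..c}")
      case True
      then have "(\<integral>r. f r s \<partial>lborel) = (LINT r:{0..s}|lborel. w r)"
        unfolding set_lebesgue_integral_def using c
        by (intro Bochner_Integration.integral_cong) (auto simp: f_def W_def indicator_def)
      then show ?thesis using velocity_eq[OF x, of s] True c by simp
    next
      case False
      then have "f r s = 0" for r by (auto simp: f_def)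
      with False show ?thesis by simp
    qed
  qed
  also have "\<dots> = (x c - c *\<^sub>R velocity x 0) - (x 0 - 0 *\<^sub>R velocity x 0)"
  proof (rule integral_FTC_atLeastAtMost)
    show "continuous_on {0..c} (\<lambda>s. velocity x s - velocity x 0)"
      using c by (intro continuous_intros continuous_on_subset[OF continuous_on_velocity[OF x]]) auto
    show "((\<lambda>s. x s - s *\<^sub>R velocity x 0) has_vector_derivative velocity x s - velocity x 0) (at s within {0..c})"
      if "0 \<le> s" "s \<le> c" for s
      using that c
      by (intro has_vector_derivative_diff has_vector_derivative_within_subset[OF has_vector_derivative_velocity[OF x]])
         (auto intro!: derivative_eq_intros simp: has_vector_derivative_def)
  qed (use c in auto)
  finally show ?thesis by simp
qed

lemma set_integrable_scaleR_continuous: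
  fixes w :: "real \<Rightarrow> 'a::euclidean_space" and k :: "real \<Rightarrow> real"
  assumes w: "set_integrable lborel {0..1} w" and k: "continuous_on {0..1} k"
  shows "set_integrable lborel {0..1} (\<lambda>r. k r *\<^sub>R w r)"
proof -
  have "bounded (k ` {0..1})" using k by (intro compact_imp_bounded compact_continuous_image) auto
  then obtain K where K: "\<And>r. r \<in> {0..1} \<Longrightarrow> \<bar>k r\<bar> \<le> K"
    unfolding bounded_iff by (metis image_eqI real_norm_def)
  have "(\<lambda>r. indicator {0..1} r *\<^sub>R k r) \<in> borel_measurable lborel"
    using borel_integrable_atLeastAtMost'[OF k] unfolding set_integrable_def by (rule borel_measurable_integrable)
  moreover have "(\<lambda>r. indicator {0..1} r *\<^sub>R w r) \<in> borel_measurable lborel"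
    using w unfolding set_integrable_def by (rule borel_measurable_integrable)
  ultimately have "(\<lambda>r. (indicator {0..1} r *\<^sub>R k r) *\<^sub>R (indicator {0..1} r *\<^sub>R w r)) \<in> borel_measurable lborel"
    by measurable
  also have "(\<lambda>r. (indicator {0..1} r *\<^sub>R k r) *\<^sub>R (indicator {0..1} r *\<^sub>R w r)) =
     (\<lambda>r. indicator {0..1} r *\<^sub>R (k r *\<^sub>R w r))"
    by (auto simp: indicator_def)
  finally have m: "set_borel_measurable lborel {0..1} (\<lambda>r. k r *\<^sub>R w r)"
    unfolding set_borel_measurable_def .
  show ?thesis
  proof (rule set_integrable_bound[OF _ m])
    show "set_integrable lborel {0..1} (\<lambda>r. K *\<^sub>R w r)"
      using w by (rule set_integrable_scaleR_right)
    show "AE r in lborel. r \<in> {0..1} \<longrightarrow> norm (k r *\<^sub>R w r) \<le> norm (K *\<^sub>R w r)"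
      using K by (intro AE_I2) (auto intro!: mult_right_mono order_trans[OF K])
  qed
qed

subsection \<open>Natural cubic splines\<close>

text \<open>Away from \<open>c\<close> the function coincides locally with a polynomial or with 0.
  At \<open>c\<close> both one-sided derivatives are 0 because the exponent is at least 2.\<close>

lemma DERIV_truncated_power:
  fixes s :: real
  assumes "k \<ge> 2"
  shows "((\<lambda>s. (max 0 (c - s)) ^ k) has_real_derivative - (of_nat k * (max 0 (c - s)) ^ (k - 1))) (at s)"
proof -
  consider "s < c" | "s > c" | "s = c" by linarith
  then show ?thesis
  proof cases
    case 1
    have "((\<lambda>s. (c - s) ^ k) has_real_derivative - (of_nat k * (c - s) ^ (k - 1))) (at s)"
      by (auto intro!: derivative_eq_intros)
    then have "((\<lambda>s. (max 0 (c - s)) ^ k) has_real_derivative - (of_nat k * (c - s) ^ (k - 1))) (at s)"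
      by (rule DERIV_cong_ev[THEN iffD1, rotated 3])
         (use 1 eventually_nhds_in_open[of "{..<c}" s] in \<open>auto elim!: eventually_mono simp: max_def\<close>)
    with 1 show ?thesis by (simp add: max_def)
  next
    case 2
    have "((\<lambda>s. 0) has_real_derivative 0) (at s)" by simp
    then have "((\<lambda>s. (max 0 (c - s)) ^ k) has_real_derivative 0) (at s)"
      by (rule DERIV_cong_ev[THEN iffD1, rotated 3])
         (use 2 assms eventually_nhds_in_open[of "{c<..}" s] in \<open>auto elim!: eventually_mono simp: max_def\<close>)
    moreover have "max 0 (c - s) = 0" using 2 by simp
    ultimately show ?thesis using assms by (simp add: power_0_left)
  next
    case 3
    \<comment> \<open>This is the difference quotient at the kink, dominated by a positive power of
      \<open>\<bar>h\<bar>\<close>.\<close>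
    have "((\<lambda>h. (max 0 (- h)) ^ k / h) \<longlongrightarrow> 0) (at (0::real))"
    proof (rule Lim_null_comparison[where g = "\<lambda>h. \<bar>h\<bar> ^ (k - 1)"])
      show "\<forall>\<^sub>F h in at (0::real). norm ((max 0 (- h)) ^ k / h) \<le> \<bar>h\<bar> ^ (k - 1)"
      proof (intro always_eventually allI)
        fix h :: real
        have "(max 0 (- h)) ^ k \<le> \<bar>h\<bar> ^ k" by (intro power_mono) auto
        also have "\<dots> = \<bar>h\<bar> ^ (k - 1) * \<bar>h\<bar>" using assms power_minus_mult[of k "\<bar>h\<bar>"] by simp
        finally show "norm ((max 0 (- h)) ^ k / h) \<le> \<bar>h\<bar> ^ (k - 1)"
          by (cases "h = 0") (auto simp: divide_le_eq power_abs)
      qed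
      have "((\<lambda>h. \<bar>h\<bar> ^ (k - 1)) \<longlongrightarrow> \<bar>0::real\<bar> ^ (k - 1)) (at 0)" by (intro tendsto_intros)
      then show "((\<lambda>h. \<bar>h\<bar> ^ (k - 1)) \<longlongrightarrow> (0::real)) (at 0)"
        using assms by (simp only: abs_zero power_0_left) simp
    qed
    with 3 assms show ?thesis by (simp add: DERIV_def power_0_left)
  qed
qed

text \<open>Equivalently, the functional summing \<open>l \<tau>\<close> times the value at
  \<open>\<tau>\<close> annihilates all affine functions.\<close>

definition spline_weights :: "real set \<Rightarrow> (real \<Rightarrow> real) \<Rightarrow> bool" where
  "spline_weights T l \<longleftrightarrow> (\<Sum>\<tau>\<in>T. l \<tau>) = 0 \<and> (\<Sum>\<tau>\<in>T. \<tau> * l \<tau>) = 0"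

text \<open>The factor 1/6 normalizes each truncated cube so that its second derivative is the
  kernel \<open>max 0 (\<tau> - s)\<close> of \<open>taylor_kernel_integral\<close>.\<close>

definition natural_spline :: "real set \<Rightarrow> real \<Rightarrow> real \<Rightarrow> (real \<Rightarrow> real) \<Rightarrow> real \<Rightarrow> real" where
  "natural_spline T a b l s = a + b * s + (\<Sum>\<tau>\<in>T. l \<tau> * ((max 0 (\<tau> - s)) ^ 3 / 6))"

definition natural_spline_deriv :: "real set \<Rightarrow> real \<Rightarrow> (real \<Rightarrow> real) \<Rightarrow> real \<Rightarrow> real" where
  "natural_spline_deriv T b l s = b - (\<Sum>\<tau>\<in>T. l \<tau> * ((max 0 (\<tau> - s)) ^ 2 / 2))"

definition natural_spline_deriv2 :: "real set \<Rightarrow> (real \<Rightarrow> real) \<Rightarrow> real \<Rightarrow> real" where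
  "natural_spline_deriv2 T l s = (\<Sum>\<tau>\<in>T. l \<tau> * max 0 (\<tau> - s))"

lemma DERIV_natural_spline:
  "(natural_spline T a b l has_real_derivative natural_spline_deriv T b l s) (at s)"
proof -
  have "((\<lambda>s. l \<tau> * ((max 0 (\<tau> - s)) ^ 3 / 6)) has_real_derivative - (l \<tau> * ((max 0 (\<tau> - s)) ^ 2 / 2))) (at s)" for \<tau>
    using DERIV_cmult[OF DERIV_truncated_power[of 3 \<tau> s], of "l \<tau> / 6"] by simp
  then have "((\<lambda>s. \<Sum>\<tau>\<in>T. l \<tau> * ((max 0 (\<tau> - s)) ^ 3 / 6)) has_real_derivative
      (\<Sum>\<tau>\<in>T. - (l \<tau> * ((max 0 (\<tau> - s)) ^ 2 / 2)))) (at s)"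
    by (rule DERIV_sum)
  moreover have "((\<lambda>s. a + b * s) has_real_derivative b) (at s)"
    by (auto intro!: derivative_eq_intros)
  ultimately have "((\<lambda>s. a + b * s + (\<Sum>\<tau>\<in>T. l \<tau> * ((max 0 (\<tau> - s)) ^ 3 / 6))) has_real_derivative
      b + (\<Sum>\<tau>\<in>T. - (l \<tau> * ((max 0 (\<tau> - s)) ^ 2 / 2)))) (at s)"
    by (intro DERIV_add)
  then show ?thesis
    unfolding natural_spline_def natural_spline_deriv_def by (simp add: sum_negf)
qed

lemma DERIV_natural_spline_deriv:
  "(natural_spline_deriv T b l has_real_derivative natural_spline_deriv2 T l s) (at s)"
proof -
  have "((\<lambda>s. l \<tau> * ((max 0 (\<tau> - s)) ^ 2 / 2)) has_real_derivative - (l \<tau> * max 0 (\<tau> - s))) (at s)" for \<tau>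
    using DERIV_cmult[OF DERIV_truncated_power[of 2 \<tau> s], of "l \<tau> / 2"] by simp
  then have "((\<lambda>s. \<Sum>\<tau>\<in>T. l \<tau> * ((max 0 (\<tau> - s)) ^ 2 / 2)) has_real_derivative
      (\<Sum>\<tau>\<in>T. - (l \<tau> * max 0 (\<tau> - s)))) (at s)"
    by (rule DERIV_sum)
  from DERIV_diff[OF DERIV_const this] show ?thesis
    unfolding natural_spline_deriv_def natural_spline_deriv2_def by (simp add: sum_negf)
qed

lemma continuous_on_natural_spline_deriv2: "continuous_on A (natural_spline_deriv2 T l)"
  unfolding natural_spline_deriv2_def by (intro continuous_intros)

lemma has_second_derivative_natural_spline:
  "has_second_derivative (natural_spline T a b l) (natural_spline_deriv2 T l)"
proof (rule has_second_derivative_C2[of _ "natural_spline_deriv T b l"])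
  show "(natural_spline T a b l has_vector_derivative natural_spline_deriv T b l s) (at s within {0..1})" for s
    using has_field_derivative_at_within[OF DERIV_natural_spline]
    by (simp flip: has_real_derivative_iff_has_vector_derivative)
  show "(natural_spline_deriv T b l has_vector_derivative natural_spline_deriv2 T l s) (at s within {0..1})" for s
    using has_field_derivative_at_within[OF DERIV_natural_spline_deriv]
    by (simp flip: has_real_derivative_iff_has_vector_derivative)
qed (rule continuous_on_natural_spline_deriv2)

text \<open>The moment conditions on the weights cancel the initial position and velocity in Taylor's formula.\<close>

lemma natural_spline_duality:
  fixes y :: "real \<Rightarrow> 'a::euclidean_space"
  assumes T: "finite T" "T \<subseteq> {0..1}" and l: "spline_weights T l" and y: "has_second_derivative y w"
  shows "(LINT r:{0..1}|lborel. natural_spline_deriv2 T l r *\<^sub>R w r) = (\<Sum>\<tau>\<in>T. l \<tau> *\<^sub>R y \<tau>)"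
proof -
  have w: "set_integrable lborel {0..1} w" using y by (rule has_second_derivative_integrable)
  have i: "set_integrable lborel {0..1} (\<lambda>r. max 0 (\<tau> - r) *\<^sub>R w r)" for \<tau>
    by (intro set_integrable_scaleR_continuous w continuous_intros)
  have "(LINT r:{0..1}|lborel. natural_spline_deriv2 T l r *\<^sub>R w r) =
      (LINT r:{0..1}|lborel. (\<Sum>\<tau>\<in>T. l \<tau> *\<^sub>R (max 0 (\<tau> - r) *\<^sub>R w r)))"
    by (simp add: natural_spline_deriv2_def scaleR_sum_left)
  also have "\<dots> = (\<Sum>\<tau>\<in>T. LINT r:{0..1}|lborel. l \<tau> *\<^sub>R (max 0 (\<tau> - r) *\<^sub>R w r))"
    using set_integrable_scaleR_right[OF i] unfolding set_lebesgue_integral_def set_integrable_def scaleR_sum_right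
    by (intro Bochner_Integration.integral_sum) auto
  also have "\<dots> = (\<Sum>\<tau>\<in>T. l \<tau> *\<^sub>R (y \<tau> - y 0 - \<tau> *\<^sub>R velocity y 0))"
    using T taylor_kernel_integral[OF y] unfolding set_integral_scaleR_right by (intro sum.cong) auto
  also have "\<dots> = (\<Sum>\<tau>\<in>T. l \<tau> *\<^sub>R y \<tau>) - (\<Sum>\<tau>\<in>T. l \<tau>) *\<^sub>R y 0 - (\<Sum>\<tau>\<in>T. \<tau> * l \<tau>) *\<^sub>R velocity y 0"
    by (simp add: algebra_simps sum_subtractf scaleR_sum_left sum.distrib)
  finally show ?thesis using l by (simp add: spline_weights_def)
qed

section \<open>Existence of interpolating natural splines\<close>

lemma natural_spline_combine:
  "natural_spline T (a + k * a') (b + k * b') (\<lambda>\<tau>. l \<tau> + k * l' \<tau>) s =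
     natural_spline T a b l s + k * natural_spline T a' b' l' s"
proof -
  have "(\<Sum>\<tau>\<in>T. (l \<tau> + k * l' \<tau>) * g \<tau>) = (\<Sum>\<tau>\<in>T. l \<tau> * g \<tau>) + k * (\<Sum>\<tau>\<in>T. l' \<tau> * g \<tau>)" for g
    by (simp add: distrib_right mult.assoc sum.distrib sum_distrib_left)
  then show ?thesis unfolding natural_spline_def by (simp only: distrib_left distrib_right mult.assoc add_ac)
qed

lemma spline_weights_combine:
  "spline_weights T l \<Longrightarrow> spline_weights T l' \<Longrightarrow> spline_weights T (\<lambda>\<tau>. l \<tau> + k * l' \<tau>)"
proof -
  have "(\<Sum>\<tau>\<in>T. l \<tau> + k * l' \<tau>) = (\<Sum>\<tau>\<in>T. l \<tau>) + k * (\<Sum>\<tau>\<in>T. l' \<tau>)"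
    "(\<Sum>\<tau>\<in>T. \<tau> * (l \<tau> + k * l' \<tau>)) = (\<Sum>\<tau>\<in>T. \<tau> * l \<tau>) + k * (\<Sum>\<tau>\<in>T. \<tau> * l' \<tau>)"
    by (simp_all add: distrib_left sum.distrib sum_distrib_left mult.left_commute)
  then show "spline_weights T l \<Longrightarrow> spline_weights T l' \<Longrightarrow> ?thesis"
    unfolding spline_weights_def by simp
qed

text \<open>Padding the weights by 0 lets a spline on the old nodes count as a spline on the
  enlarged node set.\<close>

lemma spline_superset:
  assumes "finite T'" "T \<subseteq> T'" "\<And>\<tau>. \<tau> \<in> T' - T \<Longrightarrow> l \<tau> = 0"
  shows "natural_spline T' a b l = natural_spline T a b l" "spline_weights T' l \<longleftrightarrow> spline_weights T l"
proof -
  have "(\<Sum>\<tau>\<in>T'. l \<tau> * g \<tau>) = (\<Sum>\<tau>\<in>T. l \<tau> * g \<tau>)" for g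
    using assms by (intro sum.mono_neutral_right) auto
  from this[of "\<lambda>_. 1"] this[of "\<lambda>\<tau>. \<tau>"] this
  show "natural_spline T' a b l = natural_spline T a b l" "spline_weights T' l \<longleftrightarrow> spline_weights T l"
    unfolding natural_spline_def spline_weights_def by (simp_all only: mult.commute[of _ "l _"] mult_1_right)
qed

lemma spline_cong:
  assumes "\<And>\<tau>. \<tau> \<in> T \<Longrightarrow> l \<tau> = l' \<tau>"
  shows "spline_weights T l \<longleftrightarrow> spline_weights T l'" "natural_spline T a b l = natural_spline T a b l'"
  using assms by (simp_all add: spline_weights_def natural_spline_def fun_eq_iff cong: sum.cong)

text \<open>Supplies the test curve that separates a new node from the old ones: the product of the
  linear factors of the old nodes.\<close>

lemma has_second_derivative_node_polynomial:
  assumes "finite T" "c \<notin> T"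
  obtains p w :: "real \<Rightarrow> real" where "has_second_derivative p w" "\<And>\<tau>. \<tau> \<in> T \<Longrightarrow> p \<tau> = 0" "p c \<noteq> 0"
proof -
  define q :: "real poly" where "q = (\<Prod>\<tau>\<in>T. [:- \<tau>, 1:])"
  have "has_second_derivative (poly q) (poly (pderiv (pderiv q)))"
    by (rule has_second_derivative_C2[of _ "poly (pderiv q)"])
       (auto simp: poly_DERIV DERIV_subset simp flip: has_real_derivative_iff_has_vector_derivative
         intro: DERIV_subset[OF poly_DERIV] continuous_on_poly)
  moreover have "poly q \<tau> = 0" if "\<tau> \<in> T" for \<tau>
    using that assms by (auto simp: q_def poly_prod)
  moreover have "poly q c \<noteq> 0"
    using assms by (auto simp: q_def poly_prod)
  ultimately show ?thesis using that by blast
qed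

text \<open>Adding a node \<open>c\<close>: a spline vanishing at the old nodes has energy \<open>l c * f c\<close>, which is not \<open>0\<close>
  since its second derivative is not orthogonal to that of a polynomial vanishing at the old nodes only.\<close>

lemma natural_spline_nonzero:
  assumes T: "finite T" "T \<subseteq> {0..1}" "c \<in> {0..1}" "c \<notin> T"
    and l: "spline_weights (insert c T) l" "l c \<noteq> 0"
    and zero: "\<And>\<tau>. \<tau> \<in> T \<Longrightarrow> natural_spline (insert c T) a b l \<tau> = 0"
  shows "natural_spline (insert c T) a b l c \<noteq> 0"
proof
  assume c: "natural_spline (insert c T) a b l c = 0"
  let ?w = "natural_spline_deriv2 (insert c T) l"
  have fin: "finite (insert c T)" "insert c T \<subseteq> {0..1}" using T by auto
  have hw: "has_second_derivative (natural_spline (insert c T) a b l) ?w"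
    by (rule has_second_derivative_natural_spline)
  have "(LINT r:{0..1}|lborel. ?w r *\<^sub>R ?w r) = 0"
    using natural_spline_duality[OF fin l(1) hw] T c zero by simp
  moreover have "set_integrable lborel {0..1} (\<lambda>r. ?w r *\<^sub>R ?w r)"
    using has_second_derivative_inner_integrable[OF hw hw] by simp
  ultimately have "AE r in lborel. indicator {0..1} r *\<^sub>R (?w r *\<^sub>R ?w r) = 0"
    unfolding set_integrable_def set_lebesgue_integral_def
    by (subst (asm) integral_nonneg_eq_0_iff_AE) auto
  \<comment> \<open>The spline tested against itself has zero energy, so its second derivative is 0
    almost everywhere on [0,1] and remains so after multiplication by any \<open>u\<close>.\<close>
  then have ae: "AE r in lborel. indicator {0..1} r *\<^sub>R (?w r *\<^sub>R u r) = 0" for u :: "real \<Rightarrow> real"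
    by eventually_elim auto
  obtain p u :: "real \<Rightarrow> real"
    where p: "has_second_derivative p u" "\<And>\<tau>. \<tau> \<in> T \<Longrightarrow> p \<tau> = 0" "p c \<noteq> 0"
    using has_second_derivative_node_polynomial[OF T(1,4)] by blast
  have "(LINT r:{0..1}|lborel. ?w r *\<^sub>R u r) = l c * p c"
    using natural_spline_duality[OF fin l(1) p(1)] T p(2) by simp
  moreover have "(LINT r:{0..1}|lborel. ?w r *\<^sub>R u r) = 0"
    unfolding set_lebesgue_integral_def by (rule integral_eq_zero_AE) (rule ae)
  ultimately show False using l p by simp
qed

text \<open>Induction on the interior nodes, starting from the chord with zero weights. For a new
  node \<open>c\<close>, a spline with weight 1 at \<open>c\<close> minus an interpolant of its own
  values at the old nodes gives an \<open>f\<close> that vanishes at the old nodes. By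
  \<open>natural_spline_nonzero\<close>, \<open>f c\<close> is not 0, so a multiple of
  \<open>f\<close> corrects the value at \<open>c\<close> without disturbing the others.\<close>

lemma natural_spline_interpolation:
  assumes "finite T" "T \<subseteq> {0<..<1}"
  shows "\<exists>a b l. spline_weights ({0, 1} \<union> T) l \<and> (\<forall>\<tau>\<in>{0, 1} \<union> T. natural_spline ({0, 1} \<union> T) a b l \<tau> = y \<tau>)"
  using assms
proof (induction T arbitrary: y)
  case empty
  show ?case
    by (rule exI[of _ "y 0"], rule exI[of _ "y 1 - y 0"], rule exI[of _ "\<lambda>_. 0"])
       (simp add: spline_weights_def natural_spline_def)
next
  case (insert c T)
  define N where "N = {0, 1} \<union> T"
  have c: "0 < c" "c < 1" "c \<notin> N" and N: "finite N" "N \<subseteq> {0..1}" "0 \<in> N" "1 \<in> N"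
    using insert by (auto simp: N_def less_imp_le)
  have N_insert: "{0, 1} \<union> insert c T = insert c N" by (auto simp: N_def)
  \<comment> \<open>The induction hypothesis, transported to the enlarged node set with weight 0 at
    \<open>c\<close>; the value at \<open>c\<close> is not controlled yet.\<close>
  have interp: "\<exists>a b l. spline_weights (insert c N) l \<and> l c = 0 \<and> (\<forall>\<tau>\<in>N. natural_spline (insert c N) a b l \<tau> = y \<tau>)" for y
  proof -
    from insert obtain a b l where
      *: "spline_weights N l" "\<And>\<tau>. \<tau> \<in> N \<Longrightarrow> natural_spline N a b l \<tau> = y \<tau>"
      unfolding N_def by (metis insert_subset)
    define l' where "l' = (\<lambda>\<tau>. if \<tau> = c then 0 else l \<tau>)"
    have eq: "l' \<tau> = l \<tau>" if "\<tau> \<in> N" for \<tau> using that c(3) by (auto simp: l'_def)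
    have sup: "finite (insert c N)" "N \<subseteq> insert c N" "\<And>\<tau>. \<tau> \<in> insert c N - N \<Longrightarrow> l' \<tau> = 0"
      using N by (auto simp: l'_def)
    have "spline_weights (insert c N) l' \<longleftrightarrow> spline_weights N l'"
      by (rule spline_superset(2)) (rule sup)+
    also have "\<dots> \<longleftrightarrow> spline_weights N l" by (rule spline_cong(1)) (rule eq)
    finally have "spline_weights (insert c N) l'" using *(1) by (rule iffD2)
    moreover have "natural_spline (insert c N) a b l' \<tau> = y \<tau>" if "\<tau> \<in> N" for \<tau>
    proof -
      have "natural_spline (insert c N) a b l' = natural_spline N a b l'"
        by (rule spline_superset(1)) (rule sup)+
      also have "\<dots> = natural_spline N a b l" by (rule spline_cong(2)) (rule eq)
      finally show ?thesis using *(2)[OF that] by (rule fun_cong[THEN trans])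
    qed
    moreover have "l' c = 0" by (simp add: l'_def)
    ultimately show ?thesis by blast
  qed
  \<comment> \<open>These weights represent the deviation from the chord,
    \<open>y c - (1 - c) * y 0 - c * y 1\<close>, which annihilates affine functions.\<close>
  define k where "k = (\<lambda>\<tau>. if \<tau> = c then 1 else if \<tau> = 0 then c - 1 else if \<tau> = 1 then - c else 0)"
  have "spline_weights {0, c, 1} k" using c by (simp add: spline_weights_def k_def)
  then have k: "spline_weights (insert c N) k"
    using N c spline_superset(2)[of "insert c N" "{0, c, 1}" k] by (auto simp: k_def)
  obtain a b l where l: "spline_weights (insert c N) l" "l c = 0"
      "\<And>\<tau>. \<tau> \<in> N \<Longrightarrow> natural_spline (insert c N) a b l \<tau> = natural_spline (insert c N) 0 0 k \<tau>"
    using interp[of "natural_spline (insert c N) 0 0 k"] by blast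
  \<comment> \<open>The difference of the two splines, with coefficients written in the shape that
    \<open>natural_spline_combine\<close> rewrites.\<close>
  define f where "f = natural_spline (insert c N) (0 + (-1) * a) (0 + (-1) * b) (\<lambda>\<tau>. k \<tau> + (-1) * l \<tau>)"
  have fw: "spline_weights (insert c N) (\<lambda>\<tau>. k \<tau> + (-1) * l \<tau>)"
    using k l(1) by (rule spline_weights_combine)
  have f0: "f \<tau> = 0" if "\<tau> \<in> N" for \<tau>
    using l(3)[OF that] unfolding f_def natural_spline_combine by simp
  have "f c \<noteq> 0"
    unfolding f_def
  proof (rule natural_spline_nonzero)
    show "c \<in> {0..1}" "k c + (-1) * l c \<noteq> 0" using c l(2) by (auto simp: k_def)
  qed (use N c fw f0[unfolded f_def] in auto)
  obtain a' b' l' where l': "spline_weights (insert c N) l'"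
      "\<And>\<tau>. \<tau> \<in> N \<Longrightarrow> natural_spline (insert c N) a' b' l' \<tau> = y \<tau>"
    using interp[of y] by blast
  \<comment> \<open>The multiple of \<open>f\<close> that supplies exactly the missing amount at
    \<open>c\<close>.\<close>
  define h where "h = (y c - natural_spline (insert c N) a' b' l' c) / f c"
  have "spline_weights (insert c N) (\<lambda>\<tau>. l' \<tau> + h * (k \<tau> + (-1) * l \<tau>))"
    using l'(1) fw by (rule spline_weights_combine)
  moreover have "natural_spline (insert c N) (a' + h * (0 + (-1) * a)) (b' + h * (0 + (-1) * b))
      (\<lambda>\<tau>. l' \<tau> + h * (k \<tau> + (-1) * l \<tau>)) \<tau> = y \<tau>" if "\<tau> \<in> insert c N" for \<tau>
    using that f0 l'(2) \<open>f c \<noteq> 0\<close>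
    unfolding natural_spline_combine[of _ a' h _ b' _ l'] f_def[symmetric] by (auto simp: h_def)
  ultimately show ?case unfolding N_insert by blast
qed

subsection \<open>The topology of \<open>H2\<close>\<close>

lemma set_integral_unit_interval_mono:
  fixes f g :: "real \<Rightarrow> real"
  assumes "set_integrable lborel {0..1} f" "set_integrable lborel {0..1} g"
    and "\<And>s. s \<in> {0..1} \<Longrightarrow> f s \<le> g s"
  shows "(LINT s:{0..1}|lborel. f s) \<le> (LINT s:{0..1}|lborel. g s)"
  using assms by (intro set_integral_mono) auto

lemma set_integral_unit_interval_const:
  "(LINT s::real:{0..1}|lborel. c) = (c::real)" "set_integrable lborel {0..1} (\<lambda>_::real. c)"
  by (auto simp: set_lebesgue_integral_def content_real intro: borel_integrable_atLeastAtMost')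

text \<open>Jensen's inequality on the unit interval: integrate \<open>(f - M)^2 \<ge> 0\<close>,
  where \<open>M\<close> is the mean of \<open>f\<close>.\<close>

lemma set_integral_square_le:
  fixes f :: "real \<Rightarrow> real"
  assumes f: "continuous_on {0..1} f"
  shows "(LINT s:{0..1}|lborel. f s) \<le> sqrt (LINT s:{0..1}|lborel. (f s)\<^sup>2)"
proof -
  define M where "M = (LINT s:{0..1}|lborel. f s)"
  have i: "set_integrable lborel {0..1} (\<lambda>s. 2 * M * f s - M\<^sup>2)" "set_integrable lborel {0..1} (\<lambda>s. (f s)\<^sup>2)"
     "set_integrable lborel {0..1} (\<lambda>s. 2 * M * f s)" "set_integrable lborel {0..1} (\<lambda>s::real. M\<^sup>2)"
    by (intro borel_integrable_atLeastAtMost' continuous_intros f)+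
  have "M\<^sup>2 = (LINT s:{0..1}|lborel. 2 * M * f s - M\<^sup>2)"
    unfolding set_integral_diff(2)[OF i(3,4)] set_integral_mult_right set_integral_unit_interval_const
    by (simp add: M_def power2_eq_square)
  also have "\<dots> \<le> (LINT s:{0..1}|lborel. (f s)\<^sup>2)"
  proof (rule set_integral_unit_interval_mono[OF i(1,2)])
    show "2 * M * f s - M\<^sup>2 \<le> (f s)\<^sup>2" for s
      using sum_squares_bound[of M "f s"] by simp
  qed
  finally show ?thesis unfolding M_def by (rule real_le_rsqrt)
qed

lemma set_integral_nonneg: "(\<And>s. 0 \<le> f s) \<Longrightarrow> 0 \<le> (LINT s:A|M. f s :: real)"
  unfolding set_lebesgue_integral_def by (intro integral_nonneg_AE) auto

lemma
  shows sqrt_position_le_H2_norm: "sqrt (LINT s:{0..1}|lborel. (norm (x s))\<^sup>2) \<le> H2_norm x"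
    and sqrt_velocity_le_H2_norm: "sqrt (LINT s:{0..1}|lborel. (norm (velocity x s))\<^sup>2) \<le> H2_norm x"
    and acc_energy_le_H2_norm: "acc_energy x \<le> (H2_norm x)\<^sup>2"
proof -
  have *: "0 \<le> (LINT s:{0..1}|lborel. (norm (x s))\<^sup>2)" "0 \<le> (LINT s:{0..1}|lborel. (norm (velocity x s))\<^sup>2)"
    by (intro set_integral_nonneg; simp)+
  with acc_energy_nonneg[of x]
  show "sqrt (LINT s:{0..1}|lborel. (norm (x s))\<^sup>2) \<le> H2_norm x"
    "sqrt (LINT s:{0..1}|lborel. (norm (velocity x s))\<^sup>2) \<le> H2_norm x"
    "acc_energy x \<le> (H2_norm x)\<^sup>2"
    unfolding H2_norm_def by (auto intro!: real_sqrt_le_mono)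
qed

lemma norm_increment_le:
  fixes x :: "real \<Rightarrow> 'a::euclidean_space"
  assumes x: "has_second_derivative x w" and rs: "0 \<le> r" "r \<le> s" "s \<le> 1"
  shows "norm (x s - x r) \<le> (LINT q:{0..1}|lborel. norm (velocity x q))"
proof -
  have cv: "continuous_on {0..1} (\<lambda>q. norm (velocity x q))"
    by (intro continuous_intros continuous_on_velocity[OF x])
  have "integral\<^sup>L lborel (\<lambda>q. indicator {r..s} q *\<^sub>R velocity x q) = x s - x r"
    using rs
    by (intro integral_FTC_atLeastAtMost has_vector_derivative_within_subset[OF has_vector_derivative_velocity[OF x]]
        continuous_on_subset[OF continuous_on_velocity[OF x]]) auto
  then have "norm (x s - x r) \<le> (LINT q|lborel. norm (indicator {r..s} q *\<^sub>R velocity x q))"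
    using integral_norm_bound by metis
  also have "\<dots> \<le> (LINT q:{0..1}|lborel. norm (velocity x q))"
    unfolding set_lebesgue_integral_def
  proof (rule integral_mono)
    show "integrable lborel (\<lambda>q. norm (indicator {r..s} q *\<^sub>R velocity x q))"
      using rs continuous_on_velocity[OF x]
      by (intro integrable_norm borel_integrable_compact) (auto elim: continuous_on_subset)
    show "integrable lborel (\<lambda>q. indicator {0..1} q *\<^sub>R norm (velocity x q))"
      using cv by (intro borel_integrable_compact) auto
    show "norm (indicator {r..s} q *\<^sub>R velocity x q) \<le> indicator {0..1} q *\<^sub>R norm (velocity x q)" for q
      using rs by (auto simp: indicator_def)
  qed
  finally show ?thesis .
qed

text \<open>The one-dimensional Sobolev embedding. The value at \<open>s\<close> exceeds the value
  at any \<open>r\<close> by at most the mean speed; averaging over \<open>r\<close> leaves two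
  means, each at most the norm, whence the constant 2.\<close>

lemma norm_eval_le_H2_norm:
  fixes x :: "real \<Rightarrow> 'a::euclidean_space"
  assumes x: "has_second_derivative x w" and s: "s \<in> {0..1}"
  shows "norm (x s) \<le> 2 * H2_norm x"
proof -
  define M where "M = (LINT q:{0..1}|lborel. norm (velocity x q))"
  have cx: "continuous_on {0..1} (\<lambda>q. norm (x q))"
    by (intro continuous_intros has_second_derivative_continuous_on[OF x])
  have cv: "continuous_on {0..1} (\<lambda>q. norm (velocity x q))"
    by (intro continuous_intros continuous_on_velocity[OF x])
  have le: "norm (x s) \<le> norm (x r) + M" if "r \<in> {0..1}" for r
  proof -
    have "norm (x s - x r) \<le> M"
      using norm_increment_le[OF x, of r s] norm_increment_le[OF x, of s r] s that
      by (cases "r \<le> s") (auto simp: M_def norm_minus_commute)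
    then show ?thesis using norm_triangle_ineq2[of "x s" "x r"] by linarith
  qed
  have ix: "set_integrable lborel {0..1} (\<lambda>r. norm (x r))"
    using cx by (rule borel_integrable_atLeastAtMost')
  have "norm (x s) = (LINT r::real:{0..1}|lborel. norm (x s))"
    by (simp add: set_integral_unit_interval_const)
  also have "\<dots> \<le> (LINT r:{0..1}|lborel. norm (x r) + M)"
    using le by (intro set_integral_unit_interval_mono set_integral_add ix set_integral_unit_interval_const) auto
  also have "\<dots> = (LINT r:{0..1}|lborel. norm (x r)) + M"
    using set_integral_add(2)[OF ix set_integral_unit_interval_const(2)]
    by (simp add: set_integral_unit_interval_const)
  also have "\<dots> \<le> H2_norm x + H2_norm x"
    using set_integral_square_le[OF cx] set_integral_square_le[OF cv]
      sqrt_position_le_H2_norm[of x] sqrt_velocity_le_H2_norm[of x] unfolding M_def by linarith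
  finally show ?thesis by simp
qed

lemma H2_norm_le:
  assumes x: "has_second_derivative x w"
    and K: "\<And>s. s \<in> {0..1} \<Longrightarrow> norm (x s) \<le> K"  "\<And>s. s \<in> {0..1} \<Longrightarrow> norm (velocity x s) \<le> K"
      "\<And>s. s \<in> {0..1} \<Longrightarrow> norm (w s) \<le> K"
  shows "H2_norm x \<le> 2 * K"
proof -
  have K0: "0 \<le> K" using order_trans[OF norm_ge_zero K(1)[of 0]] by simp
  have "(LINT s:{0..1}|lborel. (norm (f s))\<^sup>2) \<le> K\<^sup>2"
    if "set_integrable lborel {0..1} (\<lambda>s. (norm (f s))\<^sup>2)" "\<And>s. s \<in> {0..1} \<Longrightarrow> norm (f s) \<le> K"
    for f :: "real \<Rightarrow> 'a"
    using set_integral_unit_interval_mono[OF that(1) set_integral_unit_interval_const(2)[of "K\<^sup>2"]] that(2)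
    by (simp add: set_integral_unit_interval_const power_mono)
  note sq = this
  have "set_integrable lborel {0..1} (\<lambda>s. (norm (x s))\<^sup>2)"
      "set_integrable lborel {0..1} (\<lambda>s. (norm (velocity x s))\<^sup>2)"
    by (intro borel_integrable_atLeastAtMost' continuous_intros has_second_derivative_continuous_on[OF x]
        continuous_on_velocity[OF x])+
  moreover have "set_integrable lborel {0..1} (\<lambda>s. (norm (w s))\<^sup>2)"
    using x by (simp add: has_second_derivative_def)
  ultimately have "(LINT s:{0..1}|lborel. (norm (x s))\<^sup>2) \<le> K\<^sup>2"
      "(LINT s:{0..1}|lborel. (norm (velocity x s))\<^sup>2) \<le> K\<^sup>2" "acc_energy x \<le> K\<^sup>2"
    unfolding acc_energy_eq[OF x] using K by (blast intro: sq)+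
  \<comment> \<open>Three terms of size at most \<open>K^2\<close> are bounded by 4 of them, whose
    square root is \<open>2 * K\<close>.\<close>
  moreover have "(2 * K)\<^sup>2 = 4 * K\<^sup>2" by (simp add: power_mult_distrib)
  ultimately have "(LINT s:{0..1}|lborel. (norm (x s))\<^sup>2) + (LINT s:{0..1}|lborel. (norm (velocity x s))\<^sup>2)
      + acc_energy x \<le> (2 * K)\<^sup>2"
    using zero_le_power2[of K] by linarith
  then show ?thesis unfolding H2_norm_def using K0 by (intro real_le_lsqrt) auto
qed

lemma H2_diff: "x \<in> H2 \<Longrightarrow> y \<in> H2 \<Longrightarrow> (\<lambda>s. x s - y s) \<in> H2"
  unfolding H2_def using has_second_derivative_diff by fastforce

lemma space_H2_borel: "space H2_borel = H2"
  unfolding H2_borel_def by (rule space_measure_of) auto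

lemma open_in_sets_H2_borel:
  assumes "U \<subseteq> H2" "\<And>x. x \<in> U \<Longrightarrow> \<exists>e>0. \<forall>y\<in>H2. H2_norm (\<lambda>s. y s - x s) < e \<longrightarrow> y \<in> U"
  shows "U \<in> sets H2_borel"
  unfolding H2_borel_def using assms by (subst sets_measure_of) auto

lemma measurable_H2_borelI:
  assumes "f \<in> space M \<rightarrow> H2"
    and "\<And>U. U \<subseteq> H2 \<Longrightarrow> (\<And>x. x \<in> U \<Longrightarrow> \<exists>e>0. \<forall>y\<in>H2. H2_norm (\<lambda>s. y s - x s) < e \<longrightarrow> y \<in> U) \<Longrightarrow>
      f -` U \<inter> space M \<in> sets M"
  shows "f \<in> measurable M H2_borel"
  unfolding H2_borel_def using assms by (intro measurable_measure_of) auto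

text \<open>By the Sobolev bound, evaluation is Lipschitz with constant 2 for the norm, so preimages
  of open sets are open in \<open>H2\<close>.\<close>

lemma measurable_eval:
  assumes s: "s \<in> {0..1}"
  shows "(\<lambda>x. x s :: 'a::euclidean_space) \<in> borel_measurable H2_borel"
proof (rule borel_measurableI)
  fix S :: "'a set" assume "open S"
  show "(\<lambda>x. x s) -` S \<inter> space H2_borel \<in> sets H2_borel"
    unfolding space_H2_borel
  proof (rule open_in_sets_H2_borel)
    fix x assume x: "x \<in> (\<lambda>x. x s) -` S \<inter> H2"
    with \<open>open S\<close> obtain e where e: "e > 0" "\<And>z. dist z (x s) < e \<Longrightarrow> z \<in> S"
      by (auto simp: open_dist)
    have "y s \<in> S" if y: "y \<in> H2" "H2_norm (\<lambda>s. y s - x s) < e / 2" for y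
    proof -
      obtain w where "has_second_derivative (\<lambda>s. y s - x s) w"
        using H2_diff[OF y(1), of x] x by (auto simp: H2_def)
      from norm_eval_le_H2_norm[OF this s] y(2) show ?thesis by (intro e(2)) (simp add: dist_norm)
    qed
    with e(1) show "\<exists>e>0. \<forall>y\<in>H2. H2_norm (\<lambda>s. y s - x s) < e \<longrightarrow> y \<in> (\<lambda>x. x s) -` S \<inter> H2"
      by (intro exI[of _ "e / 2"]) auto
  qed auto
qed

text \<open>Young's inequality with a free parameter: the factor on \<open>a\<close> can be brought
  arbitrarily close to 1, at the expense of the factor on \<open>b\<close>.\<close>

lemma young_norm_add:
  fixes a b :: "'a::real_inner"
  assumes "d > 0"
  shows "(norm (a + b))\<^sup>2 \<le> (1 + d) * (norm a)\<^sup>2 + (1 + 1 / d) * (norm b)\<^sup>2"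
proof -
  \<comment> \<open>Opposite rescalings of the two vectors leave the inner product unchanged and
    distribute the weights \<open>d\<close> and \<open>1 / d\<close>.\<close>
  have "2 * (a \<bullet> b) = 2 * ((sqrt d *\<^sub>R a) \<bullet> (inverse (sqrt d) *\<^sub>R b))"
    using assms by simp
  also have "\<dots> \<le> (norm (sqrt d *\<^sub>R a))\<^sup>2 + (norm (inverse (sqrt d) *\<^sub>R b))\<^sup>2"
    using zero_le_power2[of "norm (sqrt d *\<^sub>R a - inverse (sqrt d) *\<^sub>R b)"]
    by (simp only: power2_norm_eq_inner inner_diff_left inner_diff_right inner_commute)
  also have "\<dots> = d * (norm a)\<^sup>2 + (norm b)\<^sup>2 / d"
    using assms by (simp add: power_mult_distrib power_inverse divide_inverse)
  finally show ?thesis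
    by (simp add: power2_norm_eq_inner inner_add_left inner_add_right inner_commute algebra_simps)
qed

text \<open>Takes the place of the triangle inequality for the seminorm whose square is the
  energy.\<close>

lemma acc_energy_young:
  assumes x: "has_second_derivative x w" and y: "has_second_derivative y u" and d: "d > 0"
  shows "acc_energy y \<le> (1 + d) * acc_energy x + (1 + 1 / d) * acc_energy (\<lambda>s. y s - x s)"
proof -
  have h: "has_second_derivative (\<lambda>s. y s - x s) (\<lambda>s. u s - w s)"
    using y x by (rule has_second_derivative_diff)
  note sq = x[unfolded has_second_derivative_def, THEN conjunct2, THEN conjunct1]
    y[unfolded has_second_derivative_def, THEN conjunct2, THEN conjunct1]
    h[unfolded has_second_derivative_def, THEN conjunct2, THEN conjunct1]
  have "acc_energy y \<le> (LINT s:{0..1}|lborel. (1 + d) * (norm (w s))\<^sup>2 + (1 + 1 / d) * (norm (u s - w s))\<^sup>2)"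
    unfolding acc_energy_eq[OF y]
  proof (rule set_integral_unit_interval_mono)
    show "(norm (u s))\<^sup>2 \<le> (1 + d) * (norm (w s))\<^sup>2 + (1 + 1 / d) * (norm (u s - w s))\<^sup>2" for s
      using young_norm_add[OF d, of "w s" "u s - w s"] by simp
  qed (intro sq set_integral_add set_integrable_mult_right)+
  also have "\<dots> = (1 + d) * acc_energy x + (1 + 1 / d) * acc_energy (\<lambda>s. y s - x s)"
    unfolding acc_energy_eq[OF x] acc_energy_eq[OF h]
    using sq by (subst set_integral_add(2)) auto
  finally show ?thesis .
qed

text \<open>Strict sublevel sets are norm-open: the energy of a difference is at most its squared
  norm, and Young's inequality limits how much a small difference can raise the energy.\<close>

lemma borel_measurable_acc_energy:
  "(acc_energy :: (real \<Rightarrow> 'a::euclidean_space) \<Rightarrow> real) \<in> borel_measurable H2_borel"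
  unfolding borel_measurable_iff_less
proof
  fix a :: real
  show "{x :: real \<Rightarrow> 'a \<in> space H2_borel. acc_energy x < a} \<in> sets H2_borel"
    unfolding space_H2_borel
  proof (rule open_in_sets_H2_borel)
    fix x :: "real \<Rightarrow> 'a" assume x: "x \<in> {x \<in> H2. acc_energy x < a}"
    \<comment> \<open>With this \<open>d\<close> the term \<open>d * acc_energy x\<close> uses up at
      most half of the gap to \<open>a\<close>; adding 1 keeps the denominator positive at zero
      energy.\<close>
    define d where "d = (a - acc_energy x) / (2 * (acc_energy x + 1))"
    have d: "d > 0" using x acc_energy_nonneg[of x] by (auto simp: d_def)
    have "d * acc_energy x \<le> d * (acc_energy x + 1)" using d by simp
    also have "\<dots> = (a - acc_energy x) / 2"
    proof -
      have "acc_energy x + 1 \<noteq> 0" using acc_energy_nonneg[of x] by linarith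
      then show ?thesis unfolding d_def by (metis nonzero_mult_divide_mult_cancel_right times_divide_eq_left)
    qed
    finally have gap: "a - (1 + d) * acc_energy x > 0" using x by (simp add: algebra_simps)
    \<comment> \<open>The radius is chosen so that the second term of Young's inequality at
      \<open>e^2\<close> equals the gap that remains.\<close>
    define e where "e = sqrt ((a - (1 + d) * acc_energy x) / (1 + 1 / d))"
    have dd: "1 + 1 / d > 0" using d by (intro add_pos_pos) auto
    have e: "e > 0" "(1 + 1 / d) * e\<^sup>2 = a - (1 + d) * acc_energy x"
      using gap dd by (auto simp: e_def)
    have "acc_energy y < a" if y: "y \<in> H2" "H2_norm (\<lambda>s. y s - x s) < e" for y
    proof -
      obtain w u where wu: "has_second_derivative x w" "has_second_derivative y u"
        using x y by (auto simp: H2_def)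
      have "0 \<le> H2_norm (\<lambda>s. y s - x s)"
        using sqrt_position_le_H2_norm[of "\<lambda>s. y s - x s"] by (rule order_trans[rotated]) (simp add: set_integral_nonneg)
      then have "(H2_norm (\<lambda>s. y s - x s))\<^sup>2 < e\<^sup>2" using y(2) by (intro power_strict_mono) auto
      then have "acc_energy (\<lambda>s. y s - x s) < e\<^sup>2" using acc_energy_le_H2_norm order.strict_trans1 by blast
      then have "(1 + 1 / d) * acc_energy (\<lambda>s. y s - x s) < (1 + 1 / d) * e\<^sup>2"
        using dd by (intro mult_strict_left_mono)
      then show ?thesis using acc_energy_young[OF wu d] e(2) by linarith
    qed
    with e(1) show "\<exists>e>0. \<forall>y\<in>H2. H2_norm (\<lambda>s. y s - x s) < e \<longrightarrow> y \<in> {x \<in> H2. acc_energy x < a}"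
      by (intro exI[of _ e]) auto
  qed auto
qed

subsection \<open>Cubic interpolation of tuples\<close>

text \<open>The polynomial clause of \<open>cubic_spline\<close> for a single interval, isolated so
  that it can be propagated through linear combinations.\<close>

definition cubic_on :: "real set \<Rightarrow> (real \<Rightarrow> 'a::real_vector) \<Rightarrow> bool" where
  "cubic_on S z \<longleftrightarrow> (\<exists>c0 c1 c2 c3. \<forall>s\<in>S. z s = c0 + s *\<^sub>R c1 + s^2 *\<^sub>R c2 + s^3 *\<^sub>R c3)"

lemma cubic_onI:
  "(\<And>s. s \<in> S \<Longrightarrow> z s = c0 + s *\<^sub>R c1 + s^2 *\<^sub>R c2 + s^3 *\<^sub>R c3) \<Longrightarrow> cubic_on S z"
  unfolding cubic_on_def by blast

lemma cubic_on_add: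
  assumes "cubic_on S z" "cubic_on S z'"
  shows "cubic_on S (\<lambda>s. z s + z' s)"
proof -
  obtain c0 c1 c2 c3 d0 d1 d2 d3
    where *: "\<forall>s\<in>S. z s = c0 + s *\<^sub>R c1 + s^2 *\<^sub>R c2 + s^3 *\<^sub>R c3"
      "\<forall>s\<in>S. z' s = d0 + s *\<^sub>R d1 + s^2 *\<^sub>R d2 + s^3 *\<^sub>R d3"
    using assms unfolding cubic_on_def by metis
  show ?thesis
  proof (rule cubic_onI)
    show "z s + z' s = (c0 + d0) + s *\<^sub>R (c1 + d1) + s^2 *\<^sub>R (c2 + d2) + s^3 *\<^sub>R (c3 + d3)"
      if "s \<in> S" for s
      unfolding *(1)[rule_format, OF that] *(2)[rule_format, OF that] by (simp add: scaleR_add_right)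
  qed
qed

lemma cubic_on_sum:
  assumes "\<And>i. i \<in> I \<Longrightarrow> cubic_on S (z i)"
  shows "cubic_on S (\<lambda>s. \<Sum>i\<in>I. z i s)"
  using assms
proof (induction I rule: infinite_finite_induct)
  case (insert i I)
  then show ?case using cubic_on_add[of S "z i"] by simp
qed (auto intro!: cubic_onI[of _ _ 0 0 0 0])

lemma cubic_on_scaleR:
  assumes "cubic_on S (z :: real \<Rightarrow> real)"
  shows "cubic_on S (\<lambda>s. z s *\<^sub>R v)"
proof -
  obtain c0 c1 c2 c3 where *: "\<forall>s\<in>S. z s = c0 + s *\<^sub>R c1 + s^2 *\<^sub>R c2 + s^3 *\<^sub>R c3"
    using assms unfolding cubic_on_def by metis
  show ?thesis
  proof (rule cubic_onI)
    show "z s *\<^sub>R v = c0 *\<^sub>R v + s *\<^sub>R (c1 *\<^sub>R v) + s^2 *\<^sub>R (c2 *\<^sub>R v) + s^3 *\<^sub>R (c3 *\<^sub>R v)"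
      if "s \<in> S" for s
      unfolding *[rule_format, OF that] by (simp add: scaleR_add_left)
  qed
qed

text \<open>Where no node separates points of \<open>S\<close>, each truncated cube is either
  identically 0 or an honest cubic.\<close>

lemma cubic_on_natural_spline:
  assumes "\<And>\<tau>. \<tau> \<in> T \<Longrightarrow> (\<forall>s\<in>S. \<tau> \<le> s) \<or> (\<forall>s\<in>S. s \<le> \<tau>)"
  shows "cubic_on S (natural_spline T a b l)"
proof -
  have "cubic_on S (\<lambda>s. l \<tau> * ((max 0 (\<tau> - s)) ^ 3 / 6))" if "\<tau> \<in> T" for \<tau>
    using assms[OF that]
  proof
    assume "\<forall>s\<in>S. \<tau> \<le> s"
    then show ?thesis by (intro cubic_onI[of _ _ 0 0 0 0]) auto
  next
    assume *: "\<forall>s\<in>S. s \<le> \<tau>"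
    show ?thesis
    proof (rule cubic_onI)
      show "l \<tau> * ((max 0 (\<tau> - s)) ^ 3 / 6) =
          l \<tau> * \<tau>^3 / 6 + s *\<^sub>R (- l \<tau> * \<tau>^2 / 2) + s^2 *\<^sub>R (l \<tau> * \<tau> / 2) + s^3 *\<^sub>R (- l \<tau> / 6)"
        if "s \<in> S" for s
      proof -
        have "max 0 (\<tau> - s) = \<tau> - s" using * that by auto
        then show ?thesis by (simp add: power3_eq_cube power2_eq_square field_simps)
      qed
    qed
  qed
  then have "cubic_on S (\<lambda>s. \<Sum>\<tau>\<in>T. l \<tau> * ((max 0 (\<tau> - s)) ^ 3 / 6))" by (rule cubic_on_sum)
  moreover have "cubic_on S (\<lambda>s. a + b * s)" by (rule cubic_onI[of _ _ a b 0 0]) simp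
  ultimately show ?thesis
    unfolding natural_spline_def[abs_def] using cubic_on_add by blast
qed

section \<open>Expansion of the energy and curves of zero energy\<close>

lemma acc_energy_add:
  assumes x: "has_second_derivative x w" and y: "has_second_derivative y u"
  shows "acc_energy (\<lambda>s. x s + y s) = acc_energy x + 2 * (LINT s:{0..1}|lborel. w s \<bullet> u s) + acc_energy y"
proof -
  have "acc_energy (\<lambda>s. x s + y s) = (LINT s:{0..1}|lborel. (norm (w s))\<^sup>2 + 2 * (w s \<bullet> u s) + (norm (u s))\<^sup>2)"
    unfolding acc_energy_eq[OF has_second_derivative_add[OF x y]]
    by (simp add: power2_norm_eq_inner algebra_simps inner_commute)
  also have "\<dots> = (LINT s:{0..1}|lborel. (norm (w s))\<^sup>2 + 2 * (w s \<bullet> u s)) + (LINT s:{0..1}|lborel. (norm (u s))\<^sup>2)"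
    using x y has_second_derivative_inner_integrable[OF x y]
    by (intro set_integral_add set_integrable_mult_right) (auto simp: has_second_derivative_def)
  also have "(LINT s:{0..1}|lborel. (norm (w s))\<^sup>2 + 2 * (w s \<bullet> u s)) =
      (LINT s:{0..1}|lborel. (norm (w s))\<^sup>2) + (LINT s:{0..1}|lborel. 2 * (w s \<bullet> u s))"
    using x has_second_derivative_inner_integrable[OF x y]
    by (intro set_integral_add set_integrable_mult_right) (auto simp: has_second_derivative_def)
  finally show ?thesis unfolding acc_energy_eq[OF x] acc_energy_eq[OF y] by simp
qed

text \<open>Zero energy kills the Taylor remainder at every time; the formula at time 1 then
  identifies the initial velocity with \<open>x 1 - x 0\<close>.\<close>

lemma acc_energy_eq_zero_imp_affine:
  assumes x: "has_second_derivative x w" and "acc_energy x = 0" and c: "c \<in> {0..1}"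
  shows "x c = x 0 + c *\<^sub>R (x 1 - x 0)"
proof -
  have "set_integrable lborel {0..1} (\<lambda>s. (norm (w s))\<^sup>2)"
    using x by (simp add: has_second_derivative_def)
  then have "AE s in lborel. indicator {0..1} s *\<^sub>R (norm (w s))\<^sup>2 = 0"
    using assms(2) unfolding acc_energy_eq[OF x] set_integrable_def set_lebesgue_integral_def
    by (subst (asm) integral_nonneg_eq_0_iff_AE) auto
  then have "AE s in lborel. indicator {0..1} s *\<^sub>R (max 0 (c - s) *\<^sub>R w s) = 0" for c
    by eventually_elim auto
  then have "(LINT r:{0..1}|lborel. max 0 (c - r) *\<^sub>R w r) = 0" for c
    unfolding set_lebesgue_integral_def by (rule integral_eq_zero_AE)
  then have "x c = x 0 + c *\<^sub>R velocity x 0" if "c \<in> {0..1}" for c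
    using taylor_kernel_integral[OF x that] by (simp add: algebra_simps)
  from this[OF c] this[of 1] show ?thesis by simp
qed

section \<open>Interpolation at a fixed family of nodes\<close>

locale interpolation_nodes =
  fixes n :: nat and t :: "nat \<Rightarrow> real"
  assumes two_nodes: "n \<ge> 2" and strict_mono_t: "strict_mono_on {1..n} t"
    and t_first: "t 1 = 0" and t_last: "t n = 1"
begin

definition nodes :: "real set" where "nodes = t ` {1..n}"

lemma finite_nodes: "finite nodes" by (simp add: nodes_def)

lemma t_less: "i \<in> {1..n} \<Longrightarrow> j \<in> {1..n} \<Longrightarrow> i < j \<Longrightarrow> t i < t j"
  using strict_mono_t by (rule strict_mono_onD)

lemma inj_on_t: "inj_on t {1..n}"
  using strict_mono_t by (rule strict_mono_on_imp_inj_on)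

lemma t_unit: "i \<in> {1..n} \<Longrightarrow> t i \<in> {0..1}"
proof -
  assume i: "i \<in> {1..n}"
  have "t 1 \<le> t i" using t_less[of 1 i] i by (cases "i = 1") auto
  moreover have "t i \<le> t n" using t_less[of i n] i by (cases "i = n") auto
  ultimately show ?thesis using t_first t_last by simp
qed

lemma nodes_subset: "nodes \<subseteq> {0..1}"
  using t_unit by (auto simp: nodes_def)

text \<open>Parameters are chosen rather than functions because the weights return as the
  coefficients of the cost in \<open>interpolant_cost_eq\<close>.\<close>

definition cardinal_params :: "nat \<Rightarrow> real \<times> real \<times> (real \<Rightarrow> real)" where
  "cardinal_params i = (SOME (a, b, l). spline_weights nodes l \<and>
     (\<forall>j\<in>{1..n}. natural_spline nodes a b l (t j) = (if j = i then 1 else 0)))"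

definition cardinal_weight :: "nat \<Rightarrow> real \<Rightarrow> real" where
  "cardinal_weight i = snd (snd (cardinal_params i))"

definition cardinal :: "nat \<Rightarrow> real \<Rightarrow> real" where
  "cardinal i = natural_spline nodes (fst (cardinal_params i)) (fst (snd (cardinal_params i))) (cardinal_weight i)"

definition cardinal_deriv :: "nat \<Rightarrow> real \<Rightarrow> real" where
  "cardinal_deriv i = natural_spline_deriv nodes (fst (snd (cardinal_params i))) (cardinal_weight i)"

definition cardinal_deriv2 :: "nat \<Rightarrow> real \<Rightarrow> real" where
  "cardinal_deriv2 i = natural_spline_deriv2 nodes (cardinal_weight i)"

lemma
  assumes i: "i \<in> {1..n}"
  shows spline_weights_cardinal: "spline_weights nodes (cardinal_weight i)"
    and cardinal_node: "j \<in> {1..n} \<Longrightarrow> cardinal i (t j) = (if j = i then 1 else 0)"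
proof -
  \<comment> \<open>The endpoints are removed because \<open>natural_spline_interpolation\<close>
    takes interior nodes and adds 0 and 1 itself.\<close>
  define T where "T = nodes - {0, 1}"
  have "t 1 \<in> nodes" "t n \<in> nodes" using two_nodes by (simp_all add: nodes_def)
  then have nodes: "nodes = {0, 1} \<union> T"
    using t_first t_last by (auto simp: T_def)
  have "finite T" "T \<subseteq> {0<..<1}"
    using finite_nodes nodes_subset by (auto simp: T_def subset_iff order_le_less)
  from natural_spline_interpolation[OF this, of "\<lambda>\<tau>. if \<tau> = t i then 1 else 0"]
  obtain a b l where *: "spline_weights nodes l"
      "\<And>\<tau>. \<tau> \<in> nodes \<Longrightarrow> natural_spline nodes a b l \<tau> = (if \<tau> = t i then 1 else 0)"
    unfolding nodes by blast
  define P where "P = (\<lambda>(a, b, l). spline_weights nodes l \<and>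
     (\<forall>j\<in>{1..n}. natural_spline nodes a b l (t j) = (if j = i then 1 else 0)))"
  have "natural_spline nodes a b l (t j) = (if j = i then 1 else 0)" if "j \<in> {1..n}" for j
    using *(2)[of "t j"] inj_on_eq_iff[OF inj_on_t that i] that by (simp add: nodes_def)
  with *(1) have "P (a, b, l)" by (simp add: P_def)
  then have "P (cardinal_params i)"
    unfolding cardinal_params_def P_def[symmetric] by (rule someI)
  \<comment> \<open>Writing the chosen value as an explicit triple lets the pattern in
    \<open>P\<close> reduce.\<close>
  then have "P (fst (cardinal_params i), fst (snd (cardinal_params i)), snd (snd (cardinal_params i)))" by simp
  then show "spline_weights nodes (cardinal_weight i)"
      "j \<in> {1..n} \<Longrightarrow> cardinal i (t j) = (if j = i then 1 else 0)"
    by (simp_all only: P_def prod.case cardinal_weight_def cardinal_def)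
qed

text \<open>The cutoff outside [0,1] matches the encoding of curves in \<open>H2\<close>, so that
  minimizers can be compared as total functions.\<close>

definition interp :: "(nat \<Rightarrow> 'a::euclidean_space) \<Rightarrow> real \<Rightarrow> 'a" where
  "interp x s = (if s \<in> {0..1} then \<Sum>i\<in>{1..n}. cardinal i s *\<^sub>R x i else 0)"

definition interp_deriv :: "(nat \<Rightarrow> 'a::euclidean_space) \<Rightarrow> real \<Rightarrow> 'a" where
  "interp_deriv x s = (\<Sum>i\<in>{1..n}. cardinal_deriv i s *\<^sub>R x i)"

definition interp_deriv2 :: "(nat \<Rightarrow> 'a::euclidean_space) \<Rightarrow> real \<Rightarrow> 'a" where
  "interp_deriv2 x s = (\<Sum>i\<in>{1..n}. cardinal_deriv2 i s *\<^sub>R x i)"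

lemma interp_node: "j \<in> {1..n} \<Longrightarrow> interp x (t j) = x j"
proof -
  assume j: "j \<in> {1..n}"
  then have "(\<Sum>i\<in>{1..n}. cardinal i (t j) *\<^sub>R x i) = (\<Sum>i\<in>{1..n}. if i = j then x i else 0)"
    by (intro sum.cong refl) (simp add: cardinal_node)
  with j t_unit[OF j] show ?thesis by (simp add: interp_def)
qed

lemma has_vector_derivative_interp:
  assumes s: "s \<in> {0..1}"
  shows "(interp x has_vector_derivative interp_deriv x s) (at s within {0..1})"
proof -
  have "(cardinal i has_vector_derivative cardinal_deriv i s) (at s within {0..1})" for i
    using has_field_derivative_at_within[OF DERIV_natural_spline]
    by (simp add: cardinal_def cardinal_deriv_def flip: has_real_derivative_iff_has_vector_derivative)
  then have "((\<lambda>s. \<Sum>i\<in>{1..n}. cardinal i s *\<^sub>R x i) has_vector_derivative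
      (\<Sum>i\<in>{1..n}. cardinal_deriv i s *\<^sub>R x i)) (at s within {0..1})"
    by (intro has_vector_derivative_sum bounded_linear.has_vector_derivative[OF bounded_linear_scaleR_left])
  then show ?thesis unfolding interp_deriv_def
    by (rule has_vector_derivative_transform[OF s, rotated]) (simp add: interp_def)
qed

lemma has_vector_derivative_interp_deriv:
  "(interp_deriv x has_vector_derivative interp_deriv2 x s) (at s within {0..1})"
proof -
  have "(cardinal_deriv i has_vector_derivative cardinal_deriv2 i s) (at s within {0..1})" for i
    using has_field_derivative_at_within[OF DERIV_natural_spline_deriv]
    by (simp add: cardinal_deriv_def cardinal_deriv2_def flip: has_real_derivative_iff_has_vector_derivative)
  then show ?thesis
    unfolding interp_deriv_def[abs_def] interp_deriv2_def
    by (intro has_vector_derivative_sum bounded_linear.has_vector_derivative[OF bounded_linear_scaleR_left])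
qed

lemma continuous_on_interp_deriv2: "continuous_on A (interp_deriv2 x)"
  unfolding interp_deriv2_def[abs_def] cardinal_deriv2_def
  by (intro continuous_intros continuous_on_natural_spline_deriv2)

lemma has_second_derivative_interp: "has_second_derivative (interp x) (interp_deriv2 x)"
  by (rule has_second_derivative_C2[of _ "interp_deriv x"])
     (simp_all add: has_vector_derivative_interp has_vector_derivative_interp_deriv continuous_on_interp_deriv2)

lemma interp_in_H2: "interp x \<in> H2"
  using has_second_derivative_interp[of x] by (auto simp: H2_def interp_def)

lemma velocity_interp: "s \<in> {0..1} \<Longrightarrow> velocity (interp x) s = interp_deriv x s"
  unfolding velocity_def
  using has_vector_derivative_interp[of s x] by (intro vector_derivative_within_closed_interval) auto

lemma cubic_spline_interp: "cubic_spline n t (interp x)"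
  unfolding cubic_spline_def
proof (intro conjI ballI)
  show "\<exists>v a. (\<forall>s\<in>{0..1}. (interp x has_vector_derivative v s) (at s within {0..1}) \<and>
      (v has_vector_derivative a s) (at s within {0..1})) \<and> continuous_on {0..1} a"
    using has_vector_derivative_interp has_vector_derivative_interp_deriv continuous_on_interp_deriv2 by blast
next
  fix i assume i: "i \<in> {1..<n}"
  let ?S = "{t i..t (Suc i)}"
  \<comment> \<open>No node lies strictly between two consecutive ones.\<close>
  have "(\<forall>s\<in>?S. \<tau> \<le> s) \<or> (\<forall>s\<in>?S. s \<le> \<tau>)" if "\<tau> \<in> nodes" for \<tau>
  proof -
    obtain j where j: "j \<in> {1..n}" "\<tau> = t j" using \<open>\<tau> \<in> nodes\<close> unfolding nodes_def by blast
    show ?thesis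
    proof (cases "j \<le> i")
      case True
      then have "t j \<le> t i" using t_less[of j i] i j by (cases "j = i") auto
      then show ?thesis using j by auto
    next
      case False
      then have "t (Suc i) \<le> t j" using t_less[of "Suc i" j] i j by (cases "j = Suc i") auto
      then show ?thesis using j by auto
    qed
  qed
  then have "cubic_on ?S (cardinal k)" for k
    unfolding cardinal_def by (rule cubic_on_natural_spline)
  then have "cubic_on ?S (\<lambda>s. \<Sum>k\<in>{1..n}. cardinal k s *\<^sub>R x k)"
    by (intro cubic_on_sum cubic_on_scaleR)
  moreover have "?S \<subseteq> {0..1}" using t_unit[of i] t_unit[of "Suc i"] i by auto
  then have "interp x s = (\<Sum>k\<in>{1..n}. cardinal k s *\<^sub>R x k)" if "s \<in> ?S" for s
    using that by (auto simp: interp_def)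
  ultimately show "\<exists>c0 c1 c2 c3. \<forall>s\<in>?S. interp x s = c0 + s *\<^sub>R c1 + s^2 *\<^sub>R c2 + s^3 *\<^sub>R c3"
    by (simp add: cubic_on_def)
qed

text \<open>\<open>natural_spline_duality\<close> for each cardinal spline, paired with the vector
  \<open>x i\<close>. The test curve enters only through its nodal values, which gives both the
  orthogonality and the formula for the cost.\<close>

lemma interp_duality:
  assumes y: "has_second_derivative y u"
  shows "(LINT s:{0..1}|lborel. interp_deriv2 x s \<bullet> u s) =
    (\<Sum>i\<in>{1..n}. x i \<bullet> (\<Sum>\<tau>\<in>nodes. cardinal_weight i \<tau> *\<^sub>R y \<tau>))"
proof -
  have u: "set_integrable lborel {0..1} u" using y by (rule has_second_derivative_integrable)
  have int: "integrable lborel (\<lambda>s. indicator {0..1} s *\<^sub>R (cardinal_deriv2 i s *\<^sub>R u s))" for i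
    using set_integrable_scaleR_continuous[OF u, of "cardinal_deriv2 i"] continuous_on_natural_spline_deriv2
    unfolding set_integrable_def cardinal_deriv2_def by blast
  have "(LINT s:{0..1}|lborel. interp_deriv2 x s \<bullet> u s) =
      (\<integral>s. (\<Sum>i\<in>{1..n}. x i \<bullet> (indicator {0..1} s *\<^sub>R (cardinal_deriv2 i s *\<^sub>R u s))) \<partial>lborel)"
    unfolding set_lebesgue_integral_def
  proof (intro Bochner_Integration.integral_cong refl)
    show "indicator {0..1} s *\<^sub>R (interp_deriv2 x s \<bullet> u s) =
        (\<Sum>i\<in>{1..n}. x i \<bullet> (indicator {0..1} s *\<^sub>R (cardinal_deriv2 i s *\<^sub>R u s)))" for s
      by (cases "s \<in> {0..1}") (simp_all add: interp_deriv2_def inner_sum_left)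
  qed
  also have "\<dots> = (\<Sum>i\<in>{1..n}. (\<integral>s. x i \<bullet> (indicator {0..1} s *\<^sub>R (cardinal_deriv2 i s *\<^sub>R u s)) \<partial>lborel))"
    using int by (intro Bochner_Integration.integral_sum integrable_inner_right) auto
  also have "\<dots> = (\<Sum>i\<in>{1..n}. x i \<bullet> (LINT s:{0..1}|lborel. cardinal_deriv2 i s *\<^sub>R u s))"
    using int unfolding set_lebesgue_integral_def by (intro sum.cong integral_inner_right) auto
  also have "\<dots> = (\<Sum>i\<in>{1..n}. x i \<bullet> (\<Sum>\<tau>\<in>nodes. cardinal_weight i \<tau> *\<^sub>R y \<tau>))"
    unfolding cardinal_deriv2_def
    using natural_spline_duality[OF finite_nodes nodes_subset spline_weights_cardinal y] by (intro sum.cong) auto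
  finally show ?thesis .
qed

section \<open>Orthogonality, minimality and the cost of the interpolant\<close>

lemma acc_energy_pythagoras:
  assumes y: "y \<in> H2" "\<And>i. i \<in> {1..n} \<Longrightarrow> y (t i) = x i"
  shows "acc_energy y = acc_energy (interp x) + acc_energy (\<lambda>s. y s - interp x s)"
proof -
  obtain w where w: "has_second_derivative y w" using y(1) by (auto simp: H2_def)
  define u where "u = (\<lambda>s. w s - interp_deriv2 x s)"
  have u: "has_second_derivative (\<lambda>s. y s - interp x s) u"
    unfolding u_def by (rule has_second_derivative_diff[OF w has_second_derivative_interp])
  have "y \<tau> - interp x \<tau> = 0" if "\<tau> \<in> nodes" for \<tau>
  proof -
    obtain i where i: "i \<in> {1..n}" "\<tau> = t i" using \<open>\<tau> \<in> nodes\<close> unfolding nodes_def by blast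
    then show ?thesis using y(2)[OF i(1)] interp_node[OF i(1), of x] by simp
  qed
  then have "(LINT s:{0..1}|lborel. interp_deriv2 x s \<bullet> u s) = 0"
    unfolding interp_duality[OF u] by simp
  then show ?thesis
    using acc_energy_add[OF has_second_derivative_interp[of x] u] by simp
qed

text \<open>The difference of the two curves has zero energy, hence is affine on [0,1]; it vanishes
  at both endpoints, which are nodes, and outside the interval by the encoding.\<close>

lemma interp_unique_minimizer:
  assumes y: "y \<in> H2" "\<And>i. i \<in> {1..n} \<Longrightarrow> y (t i) = x i" and le: "acc_energy y \<le> acc_energy (interp x)"
  shows "y = interp x"
proof
  fix s
  define h where "h = (\<lambda>s. y s - interp x s)"
  have "h \<in> H2" unfolding h_def by (intro H2_diff y interp_in_H2)
  then obtain u where u: "has_second_derivative h u" by (auto simp: H2_def)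
  have "acc_energy h = 0"
    using acc_energy_pythagoras[OF y] le acc_energy_nonneg[of h] by (simp add: h_def)
  note affine = acc_energy_eq_zero_imp_affine[OF u this]
  have "h (t i) = 0" if "i \<in> {1..n}" for i using y(2)[OF that] interp_node[OF that, of x] by (simp add: h_def)
  from this[of 1] this[of n] have "h 0 = 0" "h 1 = 0" using two_nodes t_first t_last by auto
  with affine[of s] have "s \<in> {0..1} \<Longrightarrow> h s = 0" by simp
  moreover have "s \<notin> {0..1} \<Longrightarrow> h s = 0" using \<open>h \<in> H2\<close> by (simp add: H2_def)
  ultimately show "y s = interp x s" by (auto simp: h_def)
qed

text \<open>Yields existence and uniqueness together, so that the \<open>THE\<close> in
  \<open>cubic_interpolant\<close> denotes \<open>interp x\<close>.\<close>

lemma is_cubic_interpolant_iff: "is_cubic_interpolant n t x z \<longleftrightarrow> z = interp x"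
proof
  assume "is_cubic_interpolant n t x z"
  then have z: "z \<in> H2" "\<And>i. i \<in> {1..n} \<Longrightarrow> z (t i) = x i"
      and "\<not> acc_energy (interp x) < acc_energy z"
    using interp_in_H2[of x] interp_node[of _ x] unfolding is_cubic_interpolant_def is_arg_min_def by blast+
  then show "z = interp x" by (intro interp_unique_minimizer) auto
next
  assume "z = interp x"
  moreover have "\<not> acc_energy y < acc_energy (interp x)"
    if "y \<in> H2" "\<forall>i\<in>{1..n}. y (t i) = x i" for y
    using acc_energy_pythagoras[of y x] that acc_energy_nonneg[of "\<lambda>s. y s - interp x s"] by simp
  ultimately show "is_cubic_interpolant n t x z"
    using interp_in_H2[of x] interp_node[of _ x] cubic_spline_interp[of x]
    unfolding is_cubic_interpolant_def is_arg_min_def by blast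
qed

lemma cubic_interpolant_eq: "cubic_interpolant n t = interp"
  by (rule ext) (simp add: cubic_interpolant_def is_cubic_interpolant_iff)

text \<open>The interpolant serves as its own test curve in \<open>interp_duality\<close>, and its
  nodal values are the data. Continuity and measurability of the cost are read off from this
  quadratic form.\<close>

lemma interpolant_cost_eq:
  "interpolant_cost n t x = (\<Sum>i\<in>{1..n}. x i \<bullet> (\<Sum>j\<in>{1..n}. cardinal_weight i (t j) *\<^sub>R x j))"
proof -
  have "interpolant_cost n t x = (LINT s:{0..1}|lborel. interp_deriv2 x s \<bullet> interp_deriv2 x s)"
    unfolding interpolant_cost_def cubic_interpolant_eq acc_energy_eq[OF has_second_derivative_interp]
    by (simp add: power2_norm_eq_inner)
  also have "\<dots> = (\<Sum>i\<in>{1..n}. x i \<bullet> (\<Sum>\<tau>\<in>nodes. cardinal_weight i \<tau> *\<^sub>R interp x \<tau>))"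
    by (rule interp_duality[OF has_second_derivative_interp])
  also have "\<dots> = (\<Sum>i\<in>{1..n}. x i \<bullet> (\<Sum>j\<in>{1..n}. cardinal_weight i (t j) *\<^sub>R x j))"
  proof -
    have "(\<Sum>\<tau>\<in>nodes. cardinal_weight i \<tau> *\<^sub>R interp x \<tau>) = (\<Sum>j\<in>{1..n}. cardinal_weight i (t j) *\<^sub>R x j)" for i
      unfolding nodes_def sum.reindex[OF inj_on_t] o_def by (intro sum.cong refl) (simp only: interp_node)
    then show ?thesis by (simp only:)
  qed
  finally show ?thesis .
qed

lemma interpolant_cost_le: "y \<in> H2 \<Longrightarrow> interpolant_cost n t (\<lambda>i\<in>{1..n}. y (t i)) \<le> acc_energy y"
  unfolding interpolant_cost_def cubic_interpolant_eq
  using acc_energy_pythagoras[of y "\<lambda>i\<in>{1..n}. y (t i)"]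
    acc_energy_nonneg[of "\<lambda>s. y s - interp (\<lambda>i\<in>{1..n}. y (t i)) s"] by simp

lemma interpolant_cost_eq_imp:
  assumes "y \<in> H2" "acc_energy y = interpolant_cost n t (\<lambda>i\<in>{1..n}. y (t i))"
  shows "interp (\<lambda>i\<in>{1..n}. y (t i)) = y"
  using assms unfolding interpolant_cost_def cubic_interpolant_eq
  using interp_unique_minimizer[of y "\<lambda>i\<in>{1..n}. y (t i)"] by simp

lemma continuous_on_interpolant_cost: "continuous_on A (interpolant_cost n t :: (nat \<Rightarrow> 'a::euclidean_space) \<Rightarrow> real)"
proof -
  have "continuous_on A (\<lambda>x :: nat \<Rightarrow> 'a. x i)" for i
    by (rule continuous_on_subset[OF continuous_on_product_coordinates]) simp
  then show ?thesis
    unfolding interpolant_cost_eq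
    by (intro continuous_on_sum continuous_on_inner continuous_on_scaleR continuous_on_const)
qed

text \<open>Extensionality of the tuple supplies the equality at indices outside
  \<open>{1..n}\<close>, where restriction returns \<open>undefined\<close>.\<close>

lemma tuple_restrict: "x \<in> tuples n \<Longrightarrow> (\<lambda>i\<in>{1..n}. interp x (t i)) = x"
  by (rule extensionalityI[of _ "{1..n}"]) (simp_all add: interp_node PiE_def)

lemma interp_diff: "interp (\<lambda>i. y i - x i) s = interp y s - interp x s"
  by (simp add: interp_def scaleR_diff_right sum_subtractf)

text \<open>The cardinal splines and their first two derivatives are continuous on a compact
  interval and finite in number, so one bound \<open>K\<close> serves them all;
  \<open>H2_norm_le\<close> contributes the factor 2.\<close>

lemma H2_norm_interp_le:
  obtains C where "C > 0" "\<And>x :: nat \<Rightarrow> 'a::euclidean_space. H2_norm (interp x) \<le> C * (\<Sum>i\<in>{1..n}. norm (x i))"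
proof -
  define B where "B = (\<lambda>i. cardinal i ` {0..1} \<union> cardinal_deriv i ` {0..1} \<union> cardinal_deriv2 i ` {0..1})"
  have "continuous_on {0..1} (cardinal i)" for i
    unfolding cardinal_def using DERIV_isCont[OF DERIV_natural_spline]
    by (simp add: continuous_at_imp_continuous_on)
  moreover have "continuous_on {0..1} (cardinal_deriv i)" for i
    unfolding cardinal_deriv_def using DERIV_isCont[OF DERIV_natural_spline_deriv]
    by (simp add: continuous_at_imp_continuous_on)
  moreover have "continuous_on {0..1} (cardinal_deriv2 i)" for i
    unfolding cardinal_deriv2_def by (rule continuous_on_natural_spline_deriv2)
  ultimately have "bounded (B i)" for i
    unfolding B_def bounded_Un by (intro conjI compact_imp_bounded compact_continuous_image compact_Icc)
  then have "bounded (\<Union>i\<in>{1..n}. B i)" by (intro bounded_UN) auto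
  then obtain K where "K > 0" and K: "\<And>z. z \<in> (\<Union>i\<in>{1..n}. B i) \<Longrightarrow> \<bar>z\<bar> \<le> K"
    unfolding bounded_pos real_norm_def by blast
  have cK: "\<bar>cardinal i s\<bar> \<le> K" "\<bar>cardinal_deriv i s\<bar> \<le> K" "\<bar>cardinal_deriv2 i s\<bar> \<le> K"
    if "i \<in> {1..n}" "s \<in> {0..1}" for i s
  proof -
    have "cardinal i s \<in> B i" "cardinal_deriv i s \<in> B i" "cardinal_deriv2 i s \<in> B i"
      using that(2) by (auto simp: B_def)
    with K that(1) show "\<bar>cardinal i s\<bar> \<le> K" "\<bar>cardinal_deriv i s\<bar> \<le> K" "\<bar>cardinal_deriv2 i s\<bar> \<le> K"
      by blast+
  qed
  have bound: "norm (\<Sum>i\<in>{1..n}. c i *\<^sub>R x i) \<le> K * (\<Sum>i\<in>{1..n}. norm (x i))"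
    if "\<And>i. i \<in> {1..n} \<Longrightarrow> \<bar>c i\<bar> \<le> K" for c and x :: "nat \<Rightarrow> 'a"
    unfolding sum_distrib_left using that by (intro sum_norm_le) (simp add: mult_right_mono)
  have "H2_norm (interp x) \<le> 2 * (K * (\<Sum>i\<in>{1..n}. norm (x i)))" for x :: "nat \<Rightarrow> 'a"
  proof (rule H2_norm_le[OF has_second_derivative_interp])
    fix s :: real assume s: "s \<in> {0..1}"
    show "norm (interp x s) \<le> K * (\<Sum>i\<in>{1..n}. norm (x i))"
    proof -
      have "norm (\<Sum>i\<in>{1..n}. cardinal i s *\<^sub>R x i) \<le> K * (\<Sum>i\<in>{1..n}. norm (x i))"
        by (rule bound[OF cK(1)[OF _ s]])
      then show ?thesis using s by (simp add: interp_def)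
    qed
    show "norm (velocity (interp x) s) \<le> K * (\<Sum>i\<in>{1..n}. norm (x i))"
      unfolding velocity_interp[OF s] interp_deriv_def by (rule bound[OF cK(2)[OF _ s]])
    show "norm (interp_deriv2 x s) \<le> K * (\<Sum>i\<in>{1..n}. norm (x i))"
      unfolding interp_deriv2_def by (rule bound[OF cK(3)[OF _ s]])
  qed
  with \<open>K > 0\<close> show ?thesis by (intro that[of "2 * K"]) (auto simp: mult.assoc)
qed

text \<open>Continuity of interpolation from the product topology on all of
  \<open>nat \<Rightarrow> 'a\<close>: by linearity, the norm bound applies to differences of data,
  and it involves finitely many coordinates only.\<close>

lemma open_interp_vimage:
  fixes U :: "(real \<Rightarrow> 'a::euclidean_space) set"
  assumes U: "\<And>x. x \<in> U \<Longrightarrow> \<exists>e>0. \<forall>y\<in>H2. H2_norm (\<lambda>s. y s - x s) < e \<longrightarrow> y \<in> U"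
  shows "open (interp -` U)"
proof (subst open_subopen, rule ballI)
  fix x :: "nat \<Rightarrow> 'a" assume "x \<in> interp -` U"
  then obtain e where e: "e > 0" "\<And>y. y \<in> H2 \<Longrightarrow> H2_norm (\<lambda>s. y s - interp x s) < e \<Longrightarrow> y \<in> U"
    using U[of "interp x"] by auto
  obtain C where C: "C > 0" "\<And>x :: nat \<Rightarrow> 'a. H2_norm (interp x) \<le> C * (\<Sum>i\<in>{1..n}. norm (x i))"
    using H2_norm_interp_le by blast
  define V where "V = {y. C * (\<Sum>i\<in>{1..n}. norm (y i - x i)) < e}"
  have "open V" unfolding V_def
    by (intro open_Collect_less continuous_intros continuous_on_product_then_coordinatewise[OF continuous_on_id])
  moreover have "x \<in> V" using e by (simp add: V_def)
  moreover have "V \<subseteq> interp -` U"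
  proof
    fix y assume "y \<in> V"
    then have "H2_norm (interp (\<lambda>i. y i - x i)) < e"
      unfolding V_def using C(2)[of "\<lambda>i. y i - x i"] by simp
    moreover have "interp (\<lambda>i. y i - x i) = (\<lambda>s. interp y s - interp x s)"
      by (simp add: fun_eq_iff interp_diff)
    ultimately show "y \<in> interp -` U" using e(2)[OF interp_in_H2[of y]] by simp
  qed
  ultimately show "\<exists>T. open T \<and> x \<in> T \<and> T \<subseteq> interp -` U" by blast
qed

text \<open>Bridges the finite product of Borel algebras and the Borel sets of the full function
  space, where continuity was proved. On extensional tuples the remaining coordinates are constantly
  \<open>undefined\<close>, hence measurable.\<close>

lemma measurable_id_tuple_borel:
  "(\<lambda>x. x) \<in> measurable (tuple_borel n) (borel :: (nat \<Rightarrow> 'a::euclidean_space) measure)"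
proof -
  have "(\<lambda>x. x) \<in> measurable (tuple_borel n) (Pi\<^sub>M UNIV (\<lambda>_. borel :: 'a measure))"
  proof (rule measurable_PiM_single')
    fix i :: nat
    show "(\<lambda>x. x i) \<in> borel_measurable (tuple_borel n :: (nat \<Rightarrow> 'a) measure)"
    proof (cases "i \<in> {1..n}")
      case False
      then have "x i = undefined" if "x \<in> space (tuple_borel n :: (nat \<Rightarrow> 'a) measure)" for x
        using that by (auto simp: space_PiM PiE_def extensional_def)
      then show ?thesis by (subst measurable_cong[where g="\<lambda>_. undefined"]) auto
    qed (rule measurable_component_singleton)
  qed auto
  then show ?thesis using measurable_cong_sets[OF refl sets_PiM_equal_borel] by blast
qed

lemma measurable_interp: "interp \<in> measurable (tuple_borel n) (H2_borel :: (real \<Rightarrow> 'a::euclidean_space) measure)"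
proof (rule measurable_H2_borelI)
  show "interp \<in> space (tuple_borel n) \<rightarrow> (H2 :: (real \<Rightarrow> 'a) set)" using interp_in_H2 by auto
  fix U :: "(real \<Rightarrow> 'a) set"
  assume "\<And>x. x \<in> U \<Longrightarrow> \<exists>e>0. \<forall>y\<in>H2. H2_norm (\<lambda>s. y s - x s) < e \<longrightarrow> y \<in> U"
  then have "open (interp -` U)" by (rule open_interp_vimage)
  then show "interp -` U \<inter> space (tuple_borel n) \<in> sets (tuple_borel n)"
    using measurable_sets[OF measurable_id_tuple_borel, of "interp -` U"] by (simp add: vimage_def)
qed

lemma borel_measurable_interpolant_cost:
  "(interpolant_cost n t :: (nat \<Rightarrow> 'a::euclidean_space) \<Rightarrow> real) \<in> borel_measurable (tuple_borel n)"
  using measurable_compose[OF measurable_id_tuple_borel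
    borel_measurable_continuous_onI[OF continuous_on_interpolant_cost]] .

lemma measurable_restrict_nodes:
  "(\<lambda>x. \<lambda>i\<in>{1..n}. x (t i)) \<in> measurable (H2_borel :: (real \<Rightarrow> 'a::euclidean_space) measure) (tuple_borel n)"
  using t_unit by (intro measurable_restrict measurable_eval)

end

subsection \<open>Plans and couplings\<close>

context interpolation_nodes
begin

context
  fixes \<rho> :: "nat \<Rightarrow> 'a::euclidean_space measure"
begin

lemma curve_plansD:
  assumes "\<mu> \<in> curve_plans n t \<rho>"
  shows "prob_space \<mu>" "sets \<mu> = sets H2_borel" "space \<mu> = H2"
    "i \<in> {1..n} \<Longrightarrow> distr \<mu> borel (\<lambda>x. x (t i)) = \<rho> i"
    "(\<lambda>x. \<lambda>i\<in>{1..n}. x (t i)) \<in> measurable \<mu> (tuple_borel n)"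
proof -
  show s: "prob_space \<mu>" "sets \<mu> = sets H2_borel" "i \<in> {1..n} \<Longrightarrow> distr \<mu> borel (\<lambda>x. x (t i)) = \<rho> i"
    using assms by (auto simp: curve_plans_def)
  from sets_eq_imp_space_eq[OF s(2)] show "space \<mu> = H2" by (simp add: space_H2_borel)
  from measurable_cong_sets[OF s(2) refl] measurable_restrict_nodes
  show "(\<lambda>x. \<lambda>i\<in>{1..n}. x (t i)) \<in> measurable \<mu> (tuple_borel n)" by blast
qed

lemma couplingsD:
  assumes "\<pi> \<in> couplings n \<rho>"
  shows "prob_space \<pi>" "sets \<pi> = sets (tuple_borel n)" "space \<pi> = tuples n"
    "i \<in> {1..n} \<Longrightarrow> distr \<pi> borel (\<lambda>x. x i) = \<rho> i" "interp \<in> measurable \<pi> H2_borel"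
proof -
  show s: "prob_space \<pi>" "sets \<pi> = sets (tuple_borel n)" "i \<in> {1..n} \<Longrightarrow> distr \<pi> borel (\<lambda>x. x i) = \<rho> i"
    using assms by (auto simp: couplings_def)
  from sets_eq_imp_space_eq[OF s(2)] show "space \<pi> = tuples n" by (simp add: space_PiM)
  from measurable_cong_sets[OF s(2) refl] measurable_interp show "interp \<in> measurable \<pi> H2_borel" by blast
qed

lemma joint_marginal_in_couplings:
  assumes \<mu>: "\<mu> \<in> curve_plans n t \<rho>"
  shows "joint_marginal n t \<mu> \<in> couplings n \<rho>"
proof -
  have "distr (joint_marginal n t \<mu>) borel (\<lambda>x. x i) = \<rho> i" if i: "i \<in> {1..n}" for i
  proof -
    have "distr (joint_marginal n t \<mu>) borel (\<lambda>x. x i) = distr \<mu> borel ((\<lambda>x. x i) \<circ> (\<lambda>x. \<lambda>i\<in>{1..n}. x (t i)))"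
      unfolding joint_marginal_def
      by (rule distr_distr[OF measurable_component_singleton[OF i] curve_plansD(5)[OF \<mu>]])
    also have "(\<lambda>x. x i) \<circ> (\<lambda>x. \<lambda>i\<in>{1..n}. x (t i)) = (\<lambda>x. x (t i))"
      using i by (simp add: fun_eq_iff)
    finally show ?thesis using curve_plansD(4)[OF \<mu> i] by simp
  qed
  moreover have "prob_space (joint_marginal n t \<mu>)"
    unfolding joint_marginal_def by (rule prob_space.prob_space_distr[OF curve_plansD(1,5)[OF \<mu>]])
  moreover have "sets (joint_marginal n t \<mu>) = sets (tuple_borel n)"
    by (simp add: joint_marginal_def)
  ultimately show ?thesis by (simp add: couplings_def)
qed

lemma coupling_cost_joint_marginal:
  assumes \<mu>: "\<mu> \<in> curve_plans n t \<rho>"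
  shows "coupling_cost n t (joint_marginal n t \<mu>) =
    (\<integral>\<^sup>+ x. ennreal (interpolant_cost n t (\<lambda>i\<in>{1..n}. x (t i))) \<partial>\<mu>)"
  unfolding coupling_cost_def joint_marginal_def
  using measurable_compose[OF borel_measurable_interpolant_cost measurable_ennreal]
  by (intro nn_integral_distr[OF curve_plansD(5)[OF \<mu>]]) (simp only: measurable_distr_eq1)

lemma coupling_cost_joint_marginal_le:
  assumes \<mu>: "\<mu> \<in> curve_plans n t \<rho>"
  shows "coupling_cost n t (joint_marginal n t \<mu>) \<le> curve_cost \<mu>"
  unfolding coupling_cost_joint_marginal[OF \<mu>] curve_cost_def
  using curve_plansD(3)[OF \<mu>] interpolant_cost_le by (intro nn_integral_mono ennreal_leI) auto

lemma spline_lift_in_curve_plans: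
  assumes \<pi>: "\<pi> \<in> couplings n \<rho>"
  shows "spline_lift n t \<pi> \<in> curve_plans n t \<rho>"
proof -
  have "distr (spline_lift n t \<pi>) borel (\<lambda>x. x (t i)) = \<rho> i" if i: "i \<in> {1..n}" for i
  proof -
    have "distr (spline_lift n t \<pi>) borel (\<lambda>x. x (t i)) = distr \<pi> borel ((\<lambda>x. x (t i)) \<circ> interp)"
      unfolding spline_lift_def cubic_interpolant_eq
      by (rule distr_distr[OF measurable_eval[OF t_unit[OF i]] couplingsD(5)[OF \<pi>]])
    also have "(\<lambda>x. x (t i)) \<circ> interp = (\<lambda>x :: nat \<Rightarrow> 'a. x i)"
      using i by (simp add: fun_eq_iff interp_node)
    finally show ?thesis using couplingsD(4)[OF \<pi> i] by simp
  qed
  moreover have "prob_space (spline_lift n t \<pi>)"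
    unfolding spline_lift_def cubic_interpolant_eq
    by (rule prob_space.prob_space_distr[OF couplingsD(1,5)[OF \<pi>]])
  moreover have "sets (spline_lift n t \<pi>) = sets H2_borel"
    by (simp add: spline_lift_def)
  ultimately show ?thesis by (simp add: curve_plans_def)
qed

lemma joint_marginal_spline_lift:
  assumes \<pi>: "\<pi> \<in> couplings n \<rho>"
  shows "joint_marginal n t (spline_lift n t \<pi>) = \<pi>"
proof -
  have "joint_marginal n t (spline_lift n t \<pi>) =
      distr \<pi> (tuple_borel n) ((\<lambda>x. \<lambda>i\<in>{1..n}. x (t i)) \<circ> interp)"
    unfolding joint_marginal_def spline_lift_def cubic_interpolant_eq
    by (rule distr_distr[OF measurable_restrict_nodes couplingsD(5)[OF \<pi>]])
  also have "\<dots> = distr \<pi> (tuple_borel n) (\<lambda>x. x)"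
    by (intro distr_cong refl) (simp only: couplingsD(3)[OF \<pi>] o_apply tuple_restrict)
  also have "\<dots> = \<pi>" using couplingsD(2)[OF \<pi>] by (intro distr_id2) simp
  finally show ?thesis .
qed

lemma curve_cost_spline_lift:
  assumes \<pi>: "\<pi> \<in> couplings n \<rho>"
  shows "curve_cost (spline_lift n t \<pi>) = coupling_cost n t \<pi>"
  unfolding curve_cost_def coupling_cost_def spline_lift_def interpolant_cost_def cubic_interpolant_eq
  using measurable_compose[OF borel_measurable_acc_energy measurable_ennreal]
  by (intro nn_integral_distr[OF couplingsD(5)[OF \<pi>]]) (simp only: measurable_distr_eq1)

text \<open>The cost of the nodal values is pointwise at most the energy, and the integrals agree
  and are finite, so the two coincide almost everywhere. Uniqueness of the minimizer then makes
  almost every curve its own interpolant.\<close>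

lemma spline_lift_joint_marginal:
  assumes \<mu>: "\<mu> \<in> curve_plans n t \<rho>" and fin: "curve_cost \<mu> < \<infinity>"
    and le: "curve_cost \<mu> \<le> coupling_cost n t (joint_marginal n t \<mu>)"
  shows "spline_lift n t (joint_marginal n t \<mu>) = \<mu>"
proof -
  let ?J = "\<lambda>x :: real \<Rightarrow> 'a. \<lambda>i\<in>{1..n}. x (t i)"
  define e where "e = (\<lambda>x :: real \<Rightarrow> 'a. ennreal (acc_energy x))"
  define c where "c = (\<lambda>x :: real \<Rightarrow> 'a. ennreal (interpolant_cost n t (?J x)))"
  note J = curve_plansD(5)[OF \<mu>] and sets = curve_plansD(2)[OF \<mu>]
  have "(acc_energy :: (real \<Rightarrow> 'a) \<Rightarrow> real) \<in> borel_measurable \<mu>"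
    using borel_measurable_acc_energy measurable_cong_sets[OF sets refl] by blast
  then have e: "e \<in> borel_measurable \<mu>" unfolding e_def by measurable
  have "(\<lambda>x. interpolant_cost n t (?J x)) \<in> borel_measurable \<mu>"
    by (rule measurable_compose[OF J borel_measurable_interpolant_cost])
  then have c: "c \<in> borel_measurable \<mu>" unfolding c_def by measurable
  have ce: "c x \<le> e x" if "x \<in> space \<mu>" for x
    using that curve_plansD(3)[OF \<mu>] interpolant_cost_le unfolding c_def e_def by (intro ennreal_leI) auto
  have eq: "(\<integral>\<^sup>+ x. c x \<partial>\<mu>) = (\<integral>\<^sup>+ x. e x \<partial>\<mu>)"
    using le coupling_cost_joint_marginal_le[OF \<mu>] coupling_cost_joint_marginal[OF \<mu>]
    unfolding curve_cost_def c_def e_def by simp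
  have fin': "(\<integral>\<^sup>+ x. e x \<partial>\<mu>) < \<infinity>" using fin by (simp add: curve_cost_def e_def)
  \<comment> \<open>Finiteness of the cost is what permits subtracting the integrals.\<close>
  have "(\<integral>\<^sup>+ x. e x - c x \<partial>\<mu>) = (\<integral>\<^sup>+ x. e x \<partial>\<mu>) - (\<integral>\<^sup>+ x. c x \<partial>\<mu>)"
    using e c eq fin' ce by (intro nn_integral_diff) auto
  also have "\<dots> = 0" using eq fin' by simp
  finally have "AE x in \<mu>. e x - c x = 0"
    using e c by (subst (asm) nn_integral_0_iff_AE) auto
  then have "AE x in \<mu>. interp (?J x) = x"
  proof (rule AE_mp, intro AE_I2 impI)
    fix x assume x: "x \<in> space \<mu>" "e x - c x = 0"
    then have H: "x \<in> H2" using curve_plansD(3)[OF \<mu>] by simp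
    have "0 \<le> interpolant_cost n t (?J x)" by (simp add: interpolant_cost_def acc_energy_nonneg)
    \<comment> \<open>Subtraction in \<open>ennreal\<close> is truncated, so a zero difference gives
      only this inequality; the converse is the pointwise bound on the cost.\<close>
    moreover have "e x \<le> c x" using x(2) by (simp add: diff_eq_0_iff_ennreal e_def)
    ultimately have "acc_energy x \<le> interpolant_cost n t (?J x)"
      by (simp add: e_def c_def ennreal_le_iff)
    with interpolant_cost_le[OF H] show "interp (?J x) = x"
      by (intro interpolant_cost_eq_imp H) simp
  qed
  then have "distr \<mu> H2_borel (interp \<circ> ?J) = distr \<mu> H2_borel (\<lambda>x. x)"
    by (intro distr_cong_AE measurable_comp[OF J measurable_interp] measurable_ident_sets[OF sets]) simp_all
  also have "\<dots> = \<mu>" using sets by (intro distr_id2) simp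
  finally show ?thesis
    unfolding spline_lift_def joint_marginal_def cubic_interpolant_eq distr_distr[OF measurable_interp J] .
qed

end

end

section \<open>Equivalence of the two variational problems\<close>

theorem corollary4:
  fixes n :: nat and t :: "nat \<Rightarrow> real" and \<rho> :: "nat \<Rightarrow> (real ^ 'd) measure"
  assumes "n \<ge> 3"
    and "strict_mono_on {1..n} t" and "t 1 = 0" and "t n = 1"
    and "\<And>i. i \<in> {1..n} \<Longrightarrow> prob_space (\<rho> i)"
    and "\<And>i. i \<in> {1..n} \<Longrightarrow> sets (\<rho> i) = sets borel"
  shows
    "(\<forall>x \<in> (tuples n :: (nat \<Rightarrow> real ^ 'd) set). \<exists>!z. is_cubic_interpolant n t x z) \<and>
     continuous_on (tuples n) (interpolant_cost n t :: (nat \<Rightarrow> real ^ 'd) \<Rightarrow> real) \<and>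
     (INF \<mu>\<in>curve_plans n t \<rho>. curve_cost \<mu>) = (INF \<pi>\<in>couplings n \<rho>. coupling_cost n t \<pi>) \<and>
     (\<forall>\<mu>\<in>curve_plans n t \<rho>.
        joint_marginal n t \<mu> \<in> couplings n \<rho> \<and>
        coupling_cost n t (joint_marginal n t \<mu>) \<le> curve_cost \<mu>) \<and>
     (\<forall>\<pi>\<in>couplings n \<rho>.
        spline_lift n t \<pi> \<in> curve_plans n t \<rho> \<and>
        joint_marginal n t (spline_lift n t \<pi>) = \<pi> \<and>
        curve_cost (spline_lift n t \<pi>) = coupling_cost n t \<pi>) \<and>
     (\<forall>\<mu>. is_arg_min curve_cost (\<lambda>\<mu>. \<mu> \<in> curve_plans n t \<rho>) \<mu> \<longrightarrow>
        is_arg_min (coupling_cost n t) (\<lambda>\<pi>. \<pi> \<in> couplings n \<rho>) (joint_marginal n t \<mu>) \<and>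
        (curve_cost \<mu> < \<infinity> \<longrightarrow> spline_lift n t (joint_marginal n t \<mu>) = \<mu>)) \<and>
     (\<forall>\<pi>. is_arg_min (coupling_cost n t) (\<lambda>\<pi>. \<pi> \<in> couplings n \<rho>) \<pi> \<longrightarrow>
        is_arg_min curve_cost (\<lambda>\<mu>. \<mu> \<in> curve_plans n t \<rho>) (spline_lift n t \<pi>))"
proof -
  interpret interpolation_nodes n t
    using assms by unfold_locales auto
  note marginal = joint_marginal_in_couplings[where \<rho> = \<rho>] coupling_cost_joint_marginal_le[where \<rho> = \<rho>]
  note lift = spline_lift_in_curve_plans[where \<rho> = \<rho>] joint_marginal_spline_lift[where \<rho> = \<rho>]
    curve_cost_spline_lift[where \<rho> = \<rho>]
  show ?thesis
  proof (intro conjI ballI allI impI)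
    show "\<exists>!z. is_cubic_interpolant n t x z" for x :: "nat \<Rightarrow> real ^ 'd"
      by (simp add: is_cubic_interpolant_iff)
    show "continuous_on (tuples n) (interpolant_cost n t :: (nat \<Rightarrow> real ^ 'd) \<Rightarrow> real)"
      by (rule continuous_on_interpolant_cost)
    show "(INF \<mu>\<in>curve_plans n t \<rho>. curve_cost \<mu>) = (INF \<pi>\<in>couplings n \<rho>. coupling_cost n t \<pi>)"
    proof (rule antisym)
      show "(INF \<mu>\<in>curve_plans n t \<rho>. curve_cost \<mu>) \<le> (INF \<pi>\<in>couplings n \<rho>. coupling_cost n t \<pi>)"
        \<comment> \<open>Every coupling is matched by its lift, a plan of the same cost.\<close>
        by (intro INF_greatest) (metis INF_lower lift(1,3))
      show "(INF \<pi>\<in>couplings n \<rho>. coupling_cost n t \<pi>) \<le> (INF \<mu>\<in>curve_plans n t \<rho>. curve_cost \<mu>)"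
        proof (rule INF_greatest)
        show "(INF \<pi>\<in>couplings n \<rho>. coupling_cost n t \<pi>) \<le> curve_cost \<mu>" if "\<mu> \<in> curve_plans n t \<rho>" for \<mu>
          using INF_lower[OF marginal(1)[OF that]] marginal(2)[OF that] by (rule order_trans)
      qed
    qed
  next
    fix \<mu> assume "is_arg_min curve_cost (\<lambda>\<mu>. \<mu> \<in> curve_plans n t \<rho>) \<mu>"
    then have \<mu>: "\<mu> \<in> curve_plans n t \<rho>" and min: "\<And>\<nu>. \<nu> \<in> curve_plans n t \<rho> \<Longrightarrow> curve_cost \<mu> \<le> curve_cost \<nu>"
      by (auto simp: is_arg_min_linorder)
    have "curve_cost \<mu> \<le> coupling_cost n t \<pi>" if "\<pi> \<in> couplings n \<rho>" for \<pi>
      using min[OF lift(1)[OF that]] lift(3)[OF that] by simp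
    with marginal[OF \<mu>]
    show "is_arg_min (coupling_cost n t) (\<lambda>\<pi>. \<pi> \<in> couplings n \<rho>) (joint_marginal n t \<mu>)"
      by (auto simp: is_arg_min_linorder intro: order_trans)
    assume "curve_cost \<mu> < \<infinity>"
    \<comment> \<open>Minimality of \<open>\<mu>\<close> against the lift of its own joint marginal
      provides the cost inequality that \<open>spline_lift_joint_marginal\<close> assumes.\<close>
    then show "spline_lift n t (joint_marginal n t \<mu>) = \<mu>"
      using \<mu> min[OF lift(1)[OF marginal(1)[OF \<mu>]]] lift(3)[OF marginal(1)[OF \<mu>]]
      by (intro spline_lift_joint_marginal) auto
  next
    fix \<pi> assume "is_arg_min (coupling_cost n t) (\<lambda>\<pi>. \<pi> \<in> couplings n \<rho>) \<pi>"
    then have \<pi>: "\<pi> \<in> couplings n \<rho>" and min: "\<And>\<sigma>. \<sigma> \<in> couplings n \<rho> \<Longrightarrow> coupling_cost n t \<pi> \<le> coupling_cost n t \<sigma>"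
      by (auto simp: is_arg_min_linorder)
    have "coupling_cost n t \<pi> \<le> curve_cost \<mu>" if "\<mu> \<in> curve_plans n t \<rho>" for \<mu>
      using min[OF marginal(1)[OF that]] marginal(2)[OF that] by (rule order_trans)
    then show "is_arg_min curve_cost (\<lambda>\<mu>. \<mu> \<in> curve_plans n t \<rho>) (spline_lift n t \<pi>)"
      using lift[OF \<pi>] by (simp add: is_arg_min_linorder)
  qed (simp_all add: marginal lift)
qed

end
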